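(* Let $n,p$ be positive integers. The minimal energy $\mathcal{E}_{n,p}$ and the corresponding minimax spherical designs are as follows. (1) If $p\ge n$, then $\mathcal{E}_{n,p}=\sqrt{n}$, and $(u_1,\dots,u_n)\in (S^{p-1})^n$ is a minimax design if and only if $u_1,\dots,u_n$ are mutually orthogonal. (2) If $p=2$ and $n\ge 1$ is arbitrary, then $\mathcal{E}_{n,2}=\dfrac{1}{\sin\left(\frac{\pi}{2n}\right)}$, and, up to rotation, permutation of the points and replacing points by their antipodes, the minimax design is the set of evenly spaced points on the upper semicircle; that is, identifying $\mathbb{R}^2$ with $\mathbb{C}$, $(u_1,\dots,u_n)\in(S^1)^n$ is a minimax design if and only if the set $\{\pm u_1,\dots,\pm u_n\}$ is the image under a rotation in $\mathrm{SO}_2(\mathbb{R})$ of $\{e^{k\pi i/n} : 0\le k\le 2n-1\}$. (3) If $p=3$ and $n=4$, then $\mathcal{E}_{4,3}=\sqrt{5}$, and $(u_1,\dots,u_4)\in(S^2)^4$ is a minimax design if and only if it is of triangular pyramid type.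
   Context: $S^{p-1}=\{v\in\mathbb{R}^p:\|v\|=1\}$ with the Euclidean norm. For $\underline{u}=(u_1,\dots,u_n)\in(S^{p-1})^n$ the energy is $E_{n,p}(\underline{u})=\max_{v\in S^{p-1}}\sum_{i=1}^n|u_i\cdot v|$, and the minimal energy is $\mathcal{E}_{n,p}=\inf_{\underline{u}\in(S^{p-1})^n}E_{n,p}(\underline{u})$. A minimax (spherical) design is a configuration $\underline{u}\in (S^{p-1})^n$ with $E_{n,p}(\underline{u})=\mathcal{E}_{n,p}$. A configuration $(u_1,u_2,u_3,u_4)\in(S^2)^4$ is of triangular pyramid type if, after possibly permuting the vectors, replacing some vectors by their negatives, and applying an element of $\mathrm{O}(3)$, $u_1$ is a pole (north or south) of $S^2$ and $u_2,u_3,u_4$ are the vertices of an equilateral triangle on the equator. *)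

theory Defs
  imports "HOL-Analysis.Analysis" "HOL-Combinatorics.Permutations"
begin

text \<open>
  A point of \<open>(S\<^sup>p\<^sup>-\<^sup>1)\<^sup>n\<close>, with \<open>p = CARD('p)\<close>, is given by \<open>u 0, \<dots>, u (n - 1)\<close>;
  the values \<open>u i\<close> for \<open>i \<ge> n\<close> are irrelevant to everything below.
\<close>
definition configs :: "nat \<Rightarrow> (nat \<Rightarrow> real ^ 'p) set" where
  "configs n = {..<n} \<rightarrow> sphere 0 1"

definition energy :: "nat \<Rightarrow> (nat \<Rightarrow> real ^ 'p) \<Rightarrow> real" where
  "energy n u = (SUP v\<in>sphere 0 1. \<Sum>i<n. \<bar>u i \<bullet> v\<bar>)"

text \<open>The supremum in \<open>energy\<close> is a maximum.\<close>
lemma energy_attained: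
  fixes u :: "nat \<Rightarrow> real ^ 'p"
  shows "\<exists>v\<in>sphere 0 1. energy n u = (\<Sum>i<n. \<bar>u i \<bullet> v\<bar>) \<and>
           (\<forall>w\<in>sphere 0 1. (\<Sum>i<n. \<bar>u i \<bullet> w\<bar>) \<le> energy n u)"
proof -
  let ?f = "\<lambda>v. \<Sum>i<n. \<bar>u i \<bullet> v\<bar>"
  have "axis undefined 1 \<in> (sphere 0 1 :: (real ^ 'p) set)"
    by (simp add: norm_axis_1)
  hence "(sphere 0 1 :: (real ^ 'p) set) \<noteq> {}" by blast
  moreover have "continuous_on (sphere 0 1) ?f"
    by (intro continuous_intros)
  ultimately obtain v where v: "v \<in> sphere 0 1" "\<forall>w\<in>sphere 0 1. ?f w \<le> ?f v"
    using continuous_attains_sup[OF compact_sphere] by blast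
  have "energy n u = ?f v"
    unfolding energy_def by (rule cSup_eq_maximum) (use v in auto)
  with v show ?thesis by auto
qed

definition min_energy :: "'p::finite itself \<Rightarrow> nat \<Rightarrow> real" where
  "min_energy _ n = (INF u\<in>(configs n :: (nat \<Rightarrow> real ^ 'p) set). energy n u)"

text \<open>The infimum in \<open>min_energy\<close> is over a nonempty set that is bounded below.\<close>
lemma configs_nonempty: "configs n \<noteq> ({} :: (nat \<Rightarrow> real ^ 'p) set)"
proof -
  have "(\<lambda>_. axis undefined 1) \<in> (configs n :: (nat \<Rightarrow> real ^ 'p) set)"
    by (simp add: configs_def norm_axis_1)
  thus ?thesis by blast
qed

lemma energy_nonneg: "0 \<le> energy n u"
  using energy_attained[of n u] by (auto intro: sum_nonneg)

definition minimax_design :: "nat \<Rightarrow> (nat \<Rightarrow> real ^ 'p) \<Rightarrow> bool" where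
  "minimax_design n u \<longleftrightarrow> u \<in> configs n \<and> energy n u = min_energy TYPE('p) n"

definition complex_to_vec :: "complex \<Rightarrow> real ^ 2" where
  "complex_to_vec z = vector [Re z, Im z]"

definition equator :: "(real ^ 3) set" where
  "equator = {x \<in> sphere 0 1. x $ 3 = 0}"

definition equilateral_triangle :: "real ^ 3 \<Rightarrow> real ^ 3 \<Rightarrow> real ^ 3 \<Rightarrow> bool" where
  "equilateral_triangle a b c \<longleftrightarrow> a \<noteq> b \<and> dist a b = dist b c \<and> dist b c = dist c a"

text \<open>The permuted, sign-changed and orthogonally transformed configuration is \<open>w\<close>.\<close>
definition triangular_pyramid_type :: "(nat \<Rightarrow> real ^ 3) \<Rightarrow> bool" where
  "triangular_pyramid_type u \<longleftrightarrow>
     (\<exists>\<sigma> s Q w. \<sigma> permutes {..<4} \<and> (\<forall>i<4. s i \<in> {1, -1 :: real}) \<and> orthogonal_matrix Q \<and>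
        (\<forall>i<4. w i = Q *v (s i *\<^sub>R u (\<sigma> i))) \<and>
        w 0 \<in> {axis 3 1, - axis 3 1} \<and>
        w 1 \<in> equator \<and> w 2 \<in> equator \<and> w 3 \<in> equator \<and>
        equilateral_triangle (w 1) (w 2) (w 3))"

end

theory Submission
  imports Defs
begin

text \<open>
  The energy of \<open>u\<close> is tested in well chosen directions, and each part has its own choice.

  If the dimension is at least \<open>n\<close>, the test directions are signed sums \<open>S\<close> of the vectors, since
  \<open>norm S\<close> is a lower bound for the energy (\<open>norm_signed_sum_le_energy\<close>). Choosing the signs
  one after the other, each new vector raises the squared norm by at least \<open>1\<close>
  (\<open>exists_signs_norm_ge\<close>), so some signed sum has norm at least \<open>sqrt n\<close>; it exceeds \<open>sqrt n\<close> when
  one starts with two vectors that are not orthogonal. Orthogonal vectors attain \<open>sqrt n\<close> by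
  Cauchy--Schwarz.

  In the plane, write the vectors up to sign as points at angles \<open>\<theta> 0 \<le> \<dots> \<le> \<theta> (n - 1)\<close> in a half
  turn. The sum of the \<open>\<bar>u i \<bullet> v\<bar>\<close> is, as a function of the angle of \<open>v\<close>, a cosine arc between
  any two consecutive zeros of its summands. Evaluated at the midpoints of these arcs and weighted
  with the sines of half their lengths, the values add up to exactly \<open>n\<close>, whatever the
  configuration. Hence \<open>n \<le> energy n u * (sum of these sines)\<close>
  (\<open>count_le_bound_times_sum_sin_half_gaps\<close>). The \<open>n\<close> arcs have total length \<open>pi\<close>, so by Jensen's
  inequality for the sine the energy is at least \<open>1 / sin (pi / (2 * n))\<close>, with equality only if
  all arcs have the same length. Evenly spaced points attain the bound because the sum of their
  sines telescopes (\<open>sum_abs_sin_le\<close>).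

  Four vectors in space satisfy a linear dependency. After sign changes and scaling its coefficients
  are nonnegative and form a unit vector. There is a probability distribution on signs, depending on
  these coefficients, under which the squared norm of the signed sum has mean exactly \<open>5\<close>
  (\<open>weighted_sign_average\<close>). If all signs have positive probability, then equality in the bound
  would make all signed sums have squared norm \<open>5\<close>, whereas their uniform average is \<open>4\<close>. So
  equality needs a vanishing probability, which happens only if one vector is absent from the
  dependency and the other three have sum \<open>0\<close>; comparing signed sums shows that the absent
  vector is orthogonal to them. Conversely, over the triangle the sum is at most twice the length of
  the horizontal part of the direction, and Cauchy--Schwarz gives \<open>sqrt 5\<close>.
\<close>

section \<open>Energies and minimax designs\<close>

lemma configs_norm:
  "u \<in> configs n \<Longrightarrow> i < n \<Longrightarrow> norm (u i) = 1"
  by (auto simp: configs_def Pi_iff dist_norm)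

lemma energy_leI:
  fixes u :: "nat \<Rightarrow> real ^ 'p"
  assumes "\<And>v. norm v = 1 \<Longrightarrow> (\<Sum>i<n. \<bar>u i \<bullet> v\<bar>) \<le> c"
  shows "energy n u \<le> c"
  using energy_attained[of n u] assms by (auto simp: dist_norm)

lemma sum_le_energy:
  fixes u :: "nat \<Rightarrow> real ^ 'p"
  assumes "norm v = 1"
  shows "(\<Sum>i<n. \<bar>u i \<bullet> v\<bar>) \<le> energy n u"
  using energy_attained[of n u] assms by (auto simp: dist_norm)

text \<open>
  Every lower bound on the energy through signs comes from testing it in the direction of a
  signed sum \<open>S\<close>: there \<open>norm S\<close> is \<open>\<Sum>i<n. e i * (u i \<bullet> v)\<close>, which is at most
  \<open>\<Sum>i<n. \<bar>u i \<bullet> v\<bar>\<close>.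
\<close>
lemma norm_signed_sum_le_energy:
  fixes u :: "nat \<Rightarrow> real ^ 'p"
  assumes "\<And>i. i < n \<Longrightarrow> \<bar>e i\<bar> = 1"
  shows "norm (\<Sum>i<n. e i *\<^sub>R u i) \<le> energy n u"
proof (cases "(\<Sum>i<n. e i *\<^sub>R u i) = 0")
  case True
  then show ?thesis by (simp add: energy_nonneg)
next
  case False
  define S where "S = (\<Sum>i<n. e i *\<^sub>R u i)"
  define v where "v = S /\<^sub>R norm S"
  have S: "norm S \<noteq> 0" using False by (simp add: S_def)
  hence v: "norm v = 1" by (simp add: v_def)
  have "S \<bullet> v = (norm S)\<^sup>2 / norm S"
    by (simp add: v_def dot_square_norm divide_inverse)
  also have "\<dots> = norm S"
    using S by (simp add: power2_eq_square)
  finally have "norm S = S \<bullet> v" ..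
  also have "\<dots> = (\<Sum>i<n. e i * (u i \<bullet> v))"
    by (simp add: S_def inner_sum_left)
  also have "\<dots> \<le> (\<Sum>i<n. \<bar>u i \<bullet> v\<bar>)"
  proof (rule sum_mono)
    fix i assume "i \<in> {..<n}"
    hence "\<bar>e i * (u i \<bullet> v)\<bar> = \<bar>u i \<bullet> v\<bar>" using assms by (simp add: abs_mult)
    thus "e i * (u i \<bullet> v) \<le> \<bar>u i \<bullet> v\<bar>" by linarith
  qed
  also have "\<dots> \<le> energy n u" by (rule sum_le_energy[OF v])
  finally show ?thesis by (simp add: S_def)
qed

text \<open>
  All three parts have this shape: a lower bound \<open>c\<close> on the energy, a property \<open>P\<close> that is
  forced by energy \<open>c\<close> and forces it, and one configuration with \<open>P\<close>.
\<close>
lemma minimax_design_iff: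
  fixes P :: "(nat \<Rightarrow> real ^ 'p) \<Rightarrow> bool"
  assumes lower: "\<And>u :: nat \<Rightarrow> real ^ 'p. u \<in> configs n \<Longrightarrow> c \<le> energy n u"
    and eq: "\<And>u. u \<in> configs n \<Longrightarrow> energy n u \<le> c \<Longrightarrow> P u"
    and upper: "\<And>u. u \<in> configs n \<Longrightarrow> P u \<Longrightarrow> energy n u \<le> c"
    and ex: "u0 \<in> configs n" "P u0"
  shows "min_energy TYPE('p) n = c \<and> (\<forall>u\<in>configs n. minimax_design n u \<longleftrightarrow> P u)"
proof -
  have "energy n u0 = c" by (intro order_antisym lower upper ex)
  hence "min_energy TYPE('p) n = c"
    unfolding min_energy_def
    by (intro cInf_eq_minimum) (use ex lower in auto)
  thus ?thesis
    unfolding minimax_design_def using lower eq upper by (metis order_antisym order_refl)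
qed

section \<open>Orthonormal configurations\<close>

lemma norm_add_scaleR_sq:
  fixes x y :: "'a::real_inner"
  shows "(norm (x + s *\<^sub>R y))\<^sup>2 = (norm x)\<^sup>2 + 2 * (s * (x \<bullet> y)) + s\<^sup>2 * (norm y)\<^sup>2"
  unfolding power2_norm_eq_inner
  by (simp add: inner_add_left inner_add_right inner_commute[of y x] power2_eq_square[of s] algebra_simps)

text \<open>
  Greedy choice of signs: adding \<open>u j\<close> with the sign of its inner product with the sum so far
  raises the squared norm by at least \<open>1\<close>. The arbitrary start \<open>S\<close> serves the equality
  case, where \<open>S\<close> is a sum of two vectors that already beats the greedy bound.
\<close>
lemma exists_signs_norm_ge:
  fixes u :: "'i \<Rightarrow> 'a::real_inner"
  assumes "finite I" "\<And>i. i \<in> I \<Longrightarrow> norm (u i) = 1"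
  shows "\<exists>e. (\<forall>i. \<bar>e i\<bar> = (1::real)) \<and>
             (norm S)\<^sup>2 + real (card I) \<le> (norm (S + (\<Sum>i\<in>I. e i *\<^sub>R u i)))\<^sup>2"
  using assms
proof (induction I)
  case empty
  show ?case by (intro exI[of _ "\<lambda>_. 1"]) simp
next
  case (insert j I)
  then obtain e where e: "\<forall>i. \<bar>e i\<bar> = (1::real)"
    and T: "(norm S)\<^sup>2 + real (card I) \<le> (norm (S + (\<Sum>i\<in>I. e i *\<^sub>R u i)))\<^sup>2"
    by auto
  define T where "T = S + (\<Sum>i\<in>I. e i *\<^sub>R u i)"
  define s :: real where "s = (if T \<bullet> u j \<ge> 0 then 1 else - 1)"
  define e' where "e' = e(j := s)"
  have abs: "\<bar>e' i\<bar> = 1" for i using e by (simp add: e'_def s_def)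
  have "(\<Sum>i\<in>I. e' i *\<^sub>R u i) = (\<Sum>i\<in>I. e i *\<^sub>R u i)"
    using insert.hyps by (intro sum.cong) (auto simp: e'_def)
  hence "S + (\<Sum>i\<in>insert j I. e' i *\<^sub>R u i) = T + s *\<^sub>R u j"
    using insert.hyps by (simp add: T_def e'_def algebra_simps)
  moreover have "(norm (T + s *\<^sub>R u j))\<^sup>2 = (norm T)\<^sup>2 + 2 * (s * (T \<bullet> u j)) + s\<^sup>2 * (norm (u j))\<^sup>2"
    by (rule norm_add_scaleR_sq)
  moreover have "s * (T \<bullet> u j) \<ge> 0" "s\<^sup>2 = 1" by (auto simp: s_def)
  ultimately have "(norm S)\<^sup>2 + real (card (insert j I))
      \<le> (norm (S + (\<Sum>i\<in>insert j I. e' i *\<^sub>R u i)))\<^sup>2"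
    using T insert.prems insert.hyps by (simp flip: T_def)
  with abs show ?case by blast
qed

lemma sqrt_le_energy:
  assumes "u \<in> configs n"
  shows "sqrt (real n) \<le> energy n u"
proof -
  obtain e where "\<forall>i. \<bar>e i\<bar> = (1::real)" and e: "real n \<le> (norm (\<Sum>i<n. e i *\<^sub>R u i))\<^sup>2"
    using exists_signs_norm_ge[of "{..<n}" u 0] configs_norm[OF assms] by auto
  hence "norm (\<Sum>i<n. e i *\<^sub>R u i) \<le> energy n u"
    by (intro norm_signed_sum_le_energy) simp
  moreover have "sqrt (real n) \<le> norm (\<Sum>i<n. e i *\<^sub>R u i)"
    using e by (intro real_le_lsqrt) auto
  ultimately show ?thesis by linarith
qed

text \<open>
  If \<open>u i \<bullet> u j \<noteq> 0\<close>, then \<open>u i \<plusminus> u j\<close> with the right sign has squared norm greater than \<open>2\<close>,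
  and greedy signs for the other \<open>n - 2\<close> vectors give a signed sum of squared norm
  greater than \<open>n\<close>.
\<close>
lemma orthogonal_if_energy_le_sqrt:
  assumes u: "u \<in> configs n" and le: "energy n u \<le> sqrt (real n)"
  shows "pairwise (\<lambda>i j. orthogonal (u i) (u j)) {..<n}"
proof (rule ccontr)
  assume "\<not> ?thesis"
  then obtain i j where ij: "i < n" "j < n" "i \<noteq> j" "u i \<bullet> u j \<noteq> 0"
    by (auto simp: pairwise_def orthogonal_def)
  define s :: real where "s = sgn (u i \<bullet> u j)"
  define I where "I = {..<n} - {i, j}"
  have I: "{..<n} = insert i (insert j I)" "i \<notin> I" "j \<notin> I" "finite I"
    using ij by (auto simp: I_def)
  obtain e where e: "\<forall>k. \<bar>e k\<bar> = (1::real)"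
    and ge: "(norm (u i + s *\<^sub>R u j))\<^sup>2 + real (card I)
               \<le> (norm (u i + s *\<^sub>R u j + (\<Sum>k\<in>I. e k *\<^sub>R u k)))\<^sup>2"
    using exists_signs_norm_ge[of I u "u i + s *\<^sub>R u j"] configs_norm[OF u] I by auto
  define e' where "e' = e(i := 1, j := s)"
  have "\<bar>s\<bar> = 1" using ij by (simp add: s_def abs_sgn_eq)
  hence abs: "\<bar>e' k\<bar> = 1" for k using e by (simp add: e'_def)
  have "(\<Sum>k\<in>I. e' k *\<^sub>R u k) = (\<Sum>k\<in>I. e k *\<^sub>R u k)"
    using I by (intro sum.cong) (auto simp: e'_def)
  hence "(\<Sum>k<n. e' k *\<^sub>R u k) = u i + s *\<^sub>R u j + (\<Sum>k\<in>I. e k *\<^sub>R u k)"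
    using I ij by (simp add: e'_def)
  with norm_signed_sum_le_energy[of n e' u] abs le
  have "norm (u i + s *\<^sub>R u j + (\<Sum>k\<in>I. e k *\<^sub>R u k)) \<le> sqrt (real n)" by simp
  hence "(norm (u i + s *\<^sub>R u j + (\<Sum>k\<in>I. e k *\<^sub>R u k)))\<^sup>2 \<le> (sqrt (real n))\<^sup>2"
    by (intro power_mono) auto
  hence "(norm (u i + s *\<^sub>R u j))\<^sup>2 + real (card I) \<le> real n" using ge by simp
  moreover have "card {..<n} = card I + 2"
    using I ij by simp
  hence "real n = real (card I) + 2" by simp
  moreover have "(norm (u i + s *\<^sub>R u j))\<^sup>2
      = (norm (u i))\<^sup>2 + 2 * (s * (u i \<bullet> u j)) + s\<^sup>2 * (norm (u j))\<^sup>2"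
    by (rule norm_add_scaleR_sq)
  moreover have "s * (u i \<bullet> u j) > 0" "s\<^sup>2 = 1"
    using ij by (auto simp: s_def sgn_if)
  ultimately show False using configs_norm[OF u] ij by simp
qed

text \<open>
  The sum \<open>\<Sum>i<n. \<bar>u i \<bullet> v\<bar>\<close> is \<open>w \<bullet> v\<close> for the signed sum \<open>w\<close> of the \<open>u i\<close> with the signs of
  the \<open>u i \<bullet> v\<close>, and by orthogonality \<open>w \<bullet> w\<close> counts the nonzero terms.
\<close>
lemma energy_le_sqrt_if_orthogonal:
  assumes u: "u \<in> configs n"
    and orth: "pairwise (\<lambda>i j. orthogonal (u i) (u j)) {..<n}"
  shows "energy n u \<le> sqrt (real n)"
proof (rule energy_leI)
  fix v :: "real ^ 'a" assume v: "norm v = 1"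
  define y where "y = (\<Sum>i<n. \<bar>u i \<bullet> v\<bar>)"
  define w where "w = (\<Sum>i<n. sgn (u i \<bullet> v) *\<^sub>R u i)"
  have "w \<bullet> w = (\<Sum>i<n. \<Sum>j<n. sgn (u i \<bullet> v) * sgn (u j \<bullet> v) * (u i \<bullet> u j))"
    unfolding w_def inner_sum_left inner_sum_right
    by (intro sum.cong refl) (simp add: inner_commute[of "u _" "u _"] mult.left_commute mult.assoc)
  also have "\<dots> = (\<Sum>i<n. \<Sum>j<n. if j = i then (sgn (u i \<bullet> v))\<^sup>2 else 0)"
    using orth configs_norm[OF u]
    by (intro sum.cong refl)
       (auto simp: pairwise_def orthogonal_def power2_eq_square dot_square_norm)
  also have "\<dots> = (\<Sum>i<n. (sgn (u i \<bullet> v))\<^sup>2)" by simp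
  also have "\<dots> \<le> (\<Sum>i<n. 1)"
    by (intro sum_mono) (simp add: sgn_if)
  finally have "norm w \<le> sqrt (real n)" by (simp add: norm_eq_sqrt_inner)
  moreover have "y = w \<bullet> v"
    by (simp add: y_def w_def inner_sum_left sgn_mult_self_eq abs_sgn mult.commute)
  moreover have "w \<bullet> v \<le> norm w * norm v" by (rule norm_cauchy_schwarz)
  ultimately show "(\<Sum>i<n. \<bar>u i \<bullet> v\<bar>) \<le> sqrt (real n)" using v by (simp add: y_def)
qed

lemma orthonormal_config_exists:
  assumes "CARD('p::finite) \<ge> n"
  shows "\<exists>u \<in> (configs n :: (nat \<Rightarrow> real ^ 'p) set).
           pairwise (\<lambda>i j. orthogonal (u i) (u j)) {..<n}"
proof -
  have "card {..<n} \<le> card (UNIV :: 'p set)" using assms by simp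
  then obtain f :: "nat \<Rightarrow> 'p" where "inj_on f {..<n}"
    using card_le_inj[of "{..<n}" "UNIV :: 'p set"] by auto
  hence "pairwise (\<lambda>i j. orthogonal (axis (f i) (1::real)) (axis (f j) 1)) {..<n}"
    by (auto simp: pairwise_def orthogonal_def inner_axis_axis inj_on_def)
  moreover have "(\<lambda>i. axis (f i) 1) \<in> (configs n :: (nat \<Rightarrow> real ^ 'p) set)"
    by (simp add: configs_def norm_axis_1)
  ultimately show ?thesis by (intro bexI[of _ "\<lambda>i. axis (f i) 1"])
qed

section \<open>Configurations on the circle\<close>

definition dir :: "real \<Rightarrow> real ^ 2" where
  "dir t = complex_to_vec (cis t)"

lemma dir_nth [simp]: "dir t $ 1 = cos t" "dir t $ 2 = sin t"
  by (simp_all add: dir_def complex_to_vec_def)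

lemma inner_dir: "dir s \<bullet> dir t = cos (s - t)"
  by (simp add: inner_vec_def sum_2 cos_diff)

lemma norm_dir [simp]: "norm (dir t) = 1"
  by (simp add: norm_eq_sqrt_inner inner_dir)

lemma dir_add_pi: "dir (t + pi) = - dir t"
  by (simp add: vec_eq_iff forall_2)

lemma norm_1_imp_dir:
  assumes "norm (x :: real ^ 2) = 1"
  obtains t where "0 \<le> t" "t < 2 * pi" "x = dir t"
proof -
  have "(norm x)\<^sup>2 = (x $ 1)\<^sup>2 + (x $ 2)\<^sup>2"
    unfolding power2_norm_eq_inner by (simp add: inner_vec_def sum_2 power2_eq_square)
  hence "(x $ 1)\<^sup>2 + (x $ 2)\<^sup>2 = 1" using assms by simp
  from sincos_total_2pi[OF this] obtain t
    where "0 \<le> t" "t < 2 * pi" "x $ 1 = cos t" "x $ 2 = sin t" .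
  thus thesis by (intro that) (simp_all add: vec_eq_iff forall_2)
qed

text \<open>
  The energy does not see the sign of a vector, so angles may be taken in a half-open half turn.
\<close>
lemma norm_1_imp_half_dir:
  assumes "norm (x :: real ^ 2) = 1"
  obtains t where "0 \<le> t" "t < pi" "x = dir t \<or> x = - dir t"
proof -
  obtain t where t: "0 \<le> t" "t < 2 * pi" "x = dir t"
    using norm_1_imp_dir[OF assms] .
  show thesis
  proof (cases "t < pi")
    case True
    thus ?thesis using t that by blast
  next
    case False
    moreover have "x = - dir (t - pi)"
      using t dir_add_pi[of "t - pi"] by simp
    ultimately show ?thesis using t by (intro that[of "t - pi"]) auto
  qed
qed

lemma dir_eqD:
  assumes "dir s = dir t" "\<bar>s - t\<bar> < 2 * pi"
  shows "s = t"
proof -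
  have "cos s = cos t" "sin s = sin t" using assms(1) by (metis dir_nth)+
  then obtain k :: int where k: "s = t + 2 * pi * k"
    using sin_cos_eq_iff[of s t] by auto
  hence "2 * pi * \<bar>real_of_int k\<bar> < 2 * pi * 1" using assms(2) by (simp add: abs_mult)
  hence "\<bar>real_of_int k\<bar> < 1" by simp
  hence "k = 0" by linarith
  thus ?thesis using k by simp
qed

definition rot :: "real \<Rightarrow> real ^ 2 ^ 2" where
  "rot a = vector [vector [cos a, - sin a], vector [sin a, cos a]]"

lemma rot_dir: "rot a *v dir t = dir (a + t)"
  by (simp add: vec_eq_iff forall_2 rot_def matrix_vector_mult_def sum_2 cos_add sin_add)

text \<open>
  For columns \<open>(p, r)\<close> and \<open>(q, s)\<close> of norm \<open>1\<close>, the quantity \<open>(p - s)\<^sup>2 + (q + r)\<^sup>2\<close> equals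
  \<open>2 - 2 * det A\<close>, so determinant \<open>1\<close> makes the second column the first one turned by a
  right angle.
\<close>
lemma rotation_matrix_iff: "rotation_matrix A \<longleftrightarrow> (\<exists>a. A = rot a)"
proof
  assume "\<exists>a. A = rot a"
  then obtain a where a: "A = rot a" ..
  have "cos a * cos a + sin a * sin a = 1"
    using sin_cos_squared_add[of a] by (simp add: power2_eq_square)
  thus "rotation_matrix A" unfolding a
    by (simp add: rotation_matrix_def orthogonal_matrix vec_eq_iff forall_2 rot_def
        matrix_matrix_mult_def transpose_def mat_def sum_2 det_2 add.commute)
next
  assume A: "rotation_matrix A"
  define p q r s where "p = A $ 1 $ 1" and "q = A $ 1 $ 2" and "r = A $ 2 $ 1" and "s = A $ 2 $ 2"
  note defs = p_def q_def r_def s_def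
  have "transpose A ** A = mat 1" "det A = 1"
    using A by (auto simp: rotation_matrix_def orthogonal_matrix)
  hence 1: "p * p + r * r = 1" "q * q + s * s = 1" "p * s - q * r = 1"
    by (simp_all add: vec_eq_iff forall_2 matrix_matrix_mult_def transpose_def mat_def sum_2 det_2 defs)
  have "(p - s)\<^sup>2 + (q + r)\<^sup>2 = (p * p + r * r) + (q * q + s * s) - 2 * (p * s - q * r)"
    by (simp add: power2_eq_square algebra_simps)
  also have "\<dots> = 0" using 1 by simp
  finally have 2: "s = p" "q = - r" by (auto simp: sum_power2_eq_zero_iff)
  obtain a where "p = cos a" "r = sin a"
    using sincos_total_2pi[of p r] 1 by (auto simp: power2_eq_square)
  with 2 have "A = rot a"
    by (simp add: vec_eq_iff forall_2 rot_def defs)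
  thus "\<exists>a. A = rot a" ..
qed

text \<open>
  The rotation of the evenly spaced set is absorbed in the angle \<open>a\<close>, so that only sums over
  angles remain.
\<close>
definition evenly_spaced :: "nat \<Rightarrow> (nat \<Rightarrow> real ^ 2) \<Rightarrow> bool" where
  "evenly_spaced n u \<longleftrightarrow>
     (\<exists>a. (\<Union>i<n. {u i, - u i}) = (\<lambda>k. dir (a + real k * pi / real n)) ` {..<2 * n})"

lemma evenly_spaced_iff_rotated_roots_of_unity:
  assumes "n \<ge> 1"
  shows "evenly_spaced n u \<longleftrightarrow>
           (\<exists>A. rotation_matrix A \<and>
              (\<Union>i<n. {u i, - u i}) =
              (\<lambda>z. A *v complex_to_vec z) `
                {exp (of_nat k * of_real pi * \<i> / of_nat n) |k. k \<in> {0..2 * n - 1}})"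
proof -
  have roots: "{exp (of_nat k * of_real pi * \<i> / of_nat n) |k. k \<in> {0..2 * n - 1}}
      = (\<lambda>k. cis (real k * pi / real n)) ` {..<2 * n}"
  proof -
    have "exp (of_nat k * of_real pi * \<i> / of_nat n) = cis (real k * pi / real n)" for k
      by (simp add: cis_conv_exp mult.commute)
    moreover have "{0..2 * n - 1} = {..<2 * n}" using assms by auto
    ultimately show ?thesis by auto
  qed
  have rotated: "(\<lambda>k. dir (a + real k * pi / real n)) ` {..<2 * n}
      = (\<lambda>z. rot a *v complex_to_vec z) ` (\<lambda>k. cis (real k * pi / real n)) ` {..<2 * n}" for a
    by (simp add: image_image flip: dir_def rot_dir)
  show ?thesis
    unfolding evenly_spaced_def roots rotation_matrix_iff rotated by blast
qed

lemma sum_abs_sin_shift: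
  assumes "n \<ge> 1"
  shows "(\<Sum>k<n. \<bar>sin (t + pi / real n + real k * pi / real n)\<bar>)
       = (\<Sum>k<n. \<bar>sin (t + real k * pi / real n)\<bar>)"
proof -
  let ?f = "\<lambda>k. \<bar>sin (t + real k * pi / real n)\<bar>"
  have "(\<Sum>k<n. \<bar>sin (t + pi / real n + real k * pi / real n)\<bar>) = (\<Sum>k<n. ?f (Suc k))"
    by (intro sum.cong refl) (simp add: algebra_simps add_divide_distrib)
  also have "\<dots> = (\<Sum>k<n. ?f k) + ?f n - ?f 0"
    using sum.lessThan_Suc_shift[of ?f n] sum.lessThan_Suc[of ?f n] by simp
  also have "?f n = ?f 0" using assms by simp
  finally show ?thesis by simp
qed

text \<open>
  Shifting \<open>t\<close> by \<open>pi / n\<close> permutes the summands, so \<open>t\<close> may be taken in \<open>[0, pi / n]\<close>. There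
  every sine is nonnegative, and multiplying by \<open>2 * sin (pi / (2 * n))\<close> makes the sum telescope
  to \<open>2 * cos (t - pi / (2 * n))\<close>.
\<close>
lemma sum_abs_sin_le:
  assumes n: "n \<ge> 1"
  shows "(\<Sum>k<n. \<bar>sin (t + real k * pi / real n)\<bar>) \<le> 1 / sin (pi / (2 * real n))"
proof -
  define h where "h t = (\<Sum>k<n. \<bar>sin (t + real k * pi / real n)\<bar>)" for t
  define c where "c = pi / (2 * real n)"
  have c: "0 < c" "c < pi" "2 * c = pi / real n" using n by (auto simp: c_def field_simps)
  have nat_shift: "h (t + real m * (pi / real n)) = h t" for t m
  proof (induction m)
    case (Suc m)
    have "h (t + real (Suc m) * (pi / real n)) = h (t + real m * (pi / real n) + pi / real n)"
      by (simp add: algebra_simps add_divide_distrib)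
    also have "\<dots> = h (t + real m * (pi / real n))"
      unfolding h_def by (rule sum_abs_sin_shift[OF n])
    finally show ?case using Suc by simp
  qed simp
  have shift: "h (t + of_int j * (pi / real n)) = h t" for t j
  proof (cases "j \<ge> 0")
    case True
    thus ?thesis using nat_shift[of t "nat j"] by simp
  next
    case False
    thus ?thesis using nat_shift[of "t + of_int j * (pi / real n)" "nat (- j)"] by simp
  qed
  have base: "h r \<le> 1 / sin c" if r: "0 \<le> r" "r \<le> pi / real n" for r
  proof -
    have pos: "sin (r + real k * pi / real n) \<ge> 0" if "k < n" for k
    proof (rule sin_ge_zero)
      have "r + real k * pi / real n \<le> pi / real n + real k * pi / real n" using r by simp
      also have "\<dots> = real (Suc k) * pi / real n"
        by (simp add: algebra_simps add_divide_distrib)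
      also have "\<dots> \<le> real n * pi / real n"
        using that by (intro divide_right_mono mult_right_mono) auto
      finally show "r + real k * pi / real n \<le> pi" using n by simp
    qed (use r in simp)
    define g where "g k = cos (r + real k * pi / real n - c)" for k
    have "2 * sin c * h r = (\<Sum>k<n. 2 * sin c * sin (r + real k * pi / real n))"
      unfolding h_def sum_distrib_left using pos by (intro sum.cong refl) simp
    also have "\<dots> = (\<Sum>k<n. g k - g (Suc k))"
    proof (intro sum.cong refl)
      fix k
      have "real (Suc k) * pi / real n = real k * pi / real n + 2 * c"
        unfolding c(3) by (simp add: distrib_right add_divide_distrib)
      hence "r + real (Suc k) * pi / real n - c = r + real k * pi / real n + c" by linarith
      thus "2 * sin c * sin (r + real k * pi / real n) = g k - g (Suc k)"
        unfolding g_def by (simp add: cos_add cos_diff)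
    qed
    also have "\<dots> = g 0 - g n" by (rule sum_lessThan_telescope')
    also have "g n = - cos (r - c)"
      using n cos_periodic_pi[of "r - c"] by (simp add: g_def algebra_simps)
    also have "g 0 - - cos (r - c) \<le> 2"
      using cos_le_one[of "r - c"] by (simp add: g_def)
    finally have "2 * sin c * h r \<le> 2" .
    moreover have "sin c > 0" using c by (intro sin_gt_zero) auto
    ultimately show ?thesis by (simp add: field_simps)
  qed
  \<comment> \<open>Reduction of \<open>t\<close> modulo \<open>pi / n\<close>.\<close>
  define j where "j = \<lfloor>t / (pi / real n)\<rfloor>"
  define r where "r = t - of_int j * (pi / real n)"
  have pos: "pi / real n > 0" using n by simp
  have "of_int j \<le> t / (pi / real n)" "t / (pi / real n) \<le> of_int j + 1"
    by (simp_all add: j_def)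
  hence "of_int j * (pi / real n) \<le> t" "t \<le> (of_int j + 1) * (pi / real n)"
    using pos by (simp_all only: pos_le_divide_eq pos_divide_le_eq)
  hence "0 \<le> r" "r \<le> pi / real n" by (simp_all add: r_def algebra_simps add_divide_distrib)
  hence "h r \<le> 1 / sin c" by (rule base)
  moreover have "h t = h r" using shift[of r j] by (simp add: r_def)
  ultimately show ?thesis by (simp add: h_def c_def)
qed

text \<open>
  The evenly spaced set has \<open>2 * n\<close> elements, so the \<open>2 * n\<close> vectors \<open>u i\<close> and \<open>- u i\<close> are
  distinct and run through it exactly once. Hence twice the sum of the \<open>\<bar>u i \<bullet> v\<bar>\<close> is the
  sum of \<open>\<bar>x \<bullet> v\<bar>\<close> over that set, which is twice a sum as in \<open>sum_abs_sin_le\<close>.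
\<close>
lemma energy_le_if_evenly_spaced:
  assumes n: "n \<ge> 1" and u: "evenly_spaced n u"
  shows "energy n u \<le> 1 / sin (pi / (2 * real n))"
proof (rule energy_leI)
  fix v :: "real ^ 2" assume "norm v = 1"
  then obtain t where v: "v = dir t" using norm_1_imp_dir by blast
  obtain a where a: "(\<Union>i<n. {u i, - u i}) = (\<lambda>k. dir (a + real k * pi / real n)) ` {..<2 * n}"
    using u by (auto simp: evenly_spaced_def)
  define d where "d k = dir (a + real k * pi / real n)" for k
  define g where "g k = (if k < n then u k else - u (k - n))" for k
  have inj_d: "inj_on d {..<2 * n}"
  proof (rule inj_onI)
    fix k l assume kl: "k \<in> {..<2 * n}" "l \<in> {..<2 * n}" "d k = d l"
    have "\<bar>real k - real l\<bar> < 2 * real n" using kl by auto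
    hence "\<bar>real k - real l\<bar> * pi / real n < 2 * real n * pi / real n"
      using n by (intro divide_strict_right_mono mult_strict_right_mono) auto
    hence "\<bar>(a + real k * pi / real n) - (a + real l * pi / real n)\<bar> < 2 * pi"
      using n by (simp add: abs_mult flip: left_diff_distrib diff_divide_distrib)
    with kl(3) have "a + real k * pi / real n = a + real l * pi / real n"
      unfolding d_def by (intro dir_eqD)
    thus "k = l" using n by simp
  qed
  have "g ` {..<2 * n} = (\<Union>i<n. {u i, - u i})"
  proof (intro equalityI subsetI)
    fix x assume "x \<in> (\<Union>i<n. {u i, - u i})"
    then obtain i where "i < n" "x = u i \<or> x = - u i" by auto
    thus "x \<in> g ` {..<2 * n}"
      by (auto simp: g_def image_iff intro: bexI[of _ i] bexI[of _ "i + n"])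
  qed (auto simp: g_def split: if_splits)
  hence img: "g ` {..<2 * n} = d ` {..<2 * n}" using a by (simp add: d_def)
  hence "card (g ` {..<2 * n}) = card {..<2 * n}" using inj_d by (simp add: card_image)
  hence inj_g: "inj_on g {..<2 * n}" by (intro eq_card_imp_inj_on) auto
  have split: "(\<Sum>k<2 * n. F k) = (\<Sum>k<n. F k) + (\<Sum>k<n. F (k + n))" for F :: "nat \<Rightarrow> real"
    using sum.atLeastLessThan_concat[of 0 n "n + n" F] sum.shift_bounds_nat_ivl[of F 0 n n]
    by (simp add: lessThan_atLeast0 mult_2)
  have "2 * (\<Sum>i<n. \<bar>u i \<bullet> v\<bar>) = (\<Sum>k<2 * n. \<bar>g k \<bullet> v\<bar>)"
    by (subst split) (simp add: g_def)
  also have "\<dots> = (\<Sum>x\<in>g ` {..<2 * n}. \<bar>x \<bullet> v\<bar>)"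
    by (simp add: sum.reindex[OF inj_g])
  also have "\<dots> = (\<Sum>k<2 * n. \<bar>d k \<bullet> v\<bar>)"
    by (simp add: img sum.reindex[OF inj_d])
  also have "\<dots> = 2 * (\<Sum>k<n. \<bar>d k \<bullet> v\<bar>)"
  proof -
    have "d (k + n) = - d k" for k
      using n dir_add_pi[of "a + real k * pi / real n"]
      by (simp add: d_def add_divide_distrib distrib_right add.assoc)
    thus ?thesis by (subst split) simp
  qed
  also have "(\<Sum>k<n. \<bar>d k \<bullet> v\<bar>) = (\<Sum>k<n. \<bar>sin ((a - t + pi / 2) + real k * pi / real n)\<bar>)"
  proof (intro sum.cong refl)
    fix k
    have "cos x = sin (x + pi / 2)" for x :: real by (simp add: sin_add)
    from this[of "a + real k * pi / real n - t"]
    show "\<bar>d k \<bullet> v\<bar> = \<bar>sin ((a - t + pi / 2) + real k * pi / real n)\<bar>"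
      by (simp add: d_def v inner_dir algebra_simps)
  qed
  also have "\<dots> \<le> 1 / sin (pi / (2 * real n))" by (rule sum_abs_sin_le[OF n])
  finally show "(\<Sum>i<n. \<bar>u i \<bullet> v\<bar>) \<le> 1 / sin (pi / (2 * real n))" by simp
qed

lemma evenly_spacedI:
  assumes n: "n \<ge> 1" and \<sigma>: "\<sigma> permutes {..<n}"
    and u: "\<And>i. i < n \<Longrightarrow> u (\<sigma> i) = dir (a + real i * pi / real n) \<or> u (\<sigma> i) = - dir (a + real i * pi / real n)"
  shows "evenly_spaced n u"
proof -
  define d where "d k = dir (a + real k * pi / real n)" for k
  have neg: "d (k + n) = - d k" for k
    using n dir_add_pi[of "a + real k * pi / real n"]
    by (simp add: d_def add_divide_distrib distrib_right add.assoc)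
  have "(\<Union>i<n. {u i, - u i}) = (\<Union>i\<in>\<sigma> ` {..<n}. {u i, - u i})"
    using permutes_image[OF \<sigma>] by simp
  also have "\<dots> = (\<Union>i<n. {d i, - d i})"
  proof -
    have "{u (\<sigma> i), - u (\<sigma> i)} = {d i, - d i}" if "i < n" for i
      using u[OF that] by (auto simp: d_def)
    thus ?thesis by simp
  qed
  also have "\<dots> = d ` {..<2 * n}"
  proof (intro equalityI subsetI)
    fix x assume "x \<in> (\<Union>i<n. {d i, - d i})"
    then obtain i where "i < n" "x = d i \<or> x = - d i" by auto
    thus "x \<in> d ` {..<2 * n}"
      using neg[of i] by (auto simp: image_iff intro: bexI[of _ i] bexI[of _ "i + n"])
  next
    fix x assume "x \<in> d ` {..<2 * n}"
    then obtain k where k: "k < 2 * n" "x = d k" by auto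
    show "x \<in> (\<Union>i<n. {d i, - d i})"
    proof (cases "k < n")
      case False
      hence "x = - d (k - n)" "k - n < n" using k neg[of "k - n"] by auto
      thus ?thesis by auto
    qed (use k in auto)
  qed
  finally show ?thesis unfolding evenly_spaced_def d_def by blast
qed

lemma evenly_spaced_config_exists:
  assumes "n \<ge> 1"
  shows "\<exists>u\<in>configs n. evenly_spaced n u"
proof
  let ?u = "\<lambda>k. dir (0 + real k * pi / real n)"
  show "?u \<in> configs n" by (simp add: configs_def)
  show "evenly_spaced n ?u"
    by (rule evenly_spacedI[where \<sigma> = id and a = 0]) (use assms in \<open>auto simp: permutes_id\<close>)
qed

text \<open>
  Test the sum in the midpoint \<open>m k\<close> of each gap between consecutive angles and weight the results
  with the sines of half the gaps. At \<open>m k\<close> the sines with \<open>i \<le> k\<close> are counted positively and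
  those with \<open>i > k\<close> negatively, which can only lower the sum of absolute values. The product
  formula turns each weighted sine into a difference of cosines at the two ends of the gap, and
  for fixed \<open>i\<close> the sum over \<open>k\<close> telescopes to \<open>2\<close>, whatever the angles are.
\<close>
lemma count_le_bound_times_sum_sin_half_gaps:
  fixes \<theta> :: "nat \<Rightarrow> real"
  assumes mono: "\<And>i j. i \<le> j \<Longrightarrow> j \<le> n \<Longrightarrow> \<theta> i \<le> \<theta> j"
    and last: "\<theta> n = \<theta> 0 + pi"
    and R: "\<And>t. (\<Sum>i<n. \<bar>sin (t - \<theta> i)\<bar>) \<le> R"
  shows "real n \<le> R * (\<Sum>k<n. sin ((\<theta> (Suc k) - \<theta> k) / 2))"
proof -
  define s where "s i k = (if i \<le> k then 1 else - 1 :: real)" for i k :: nat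
  define m where "m k = (\<theta> k + \<theta> (Suc k)) / 2" for k
  define \<alpha> where "\<alpha> k = (\<theta> (Suc k) - \<theta> k) / 2" for k
  define C where "C i k = cos (\<theta> k - \<theta> i)" for i k
  have prod: "2 * sin (\<alpha> k) * sin (m k - \<theta> i) = C i k - C i (Suc k)" for i k
  proof -
    have "\<theta> k - \<theta> i = (m k - \<theta> i) - \<alpha> k" "\<theta> (Suc k) - \<theta> i = (m k - \<theta> i) + \<alpha> k"
      by (simp_all add: m_def \<alpha>_def field_simps)
    thus ?thesis unfolding C_def by (simp only: cos_add cos_diff) simp
  qed
  \<comment> \<open>The cosines telescope up from \<open>0\<close> to \<open>i\<close> and down from \<open>i\<close> to \<open>n\<close>; the two end terms
    cancel because \<open>\<theta> n\<close> and \<open>\<theta> 0\<close> differ by a half turn.\<close>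
  have row: "(\<Sum>k<n. s i k * (C i k - C i (Suc k))) = 2" if i: "i < n" for i
  proof -
    have "(\<Sum>k<n. s i k * (C i k - C i (Suc k)))
        = (\<Sum>k<i. s i k * (C i k - C i (Suc k))) + (\<Sum>k=i..<n. s i k * (C i k - C i (Suc k)))"
      using sum.atLeastLessThan_concat[of 0 i n "\<lambda>k. s i k * (C i k - C i (Suc k))"] i
      by (simp add: lessThan_atLeast0)
    also have "(\<Sum>k<i. s i k * (C i k - C i (Suc k))) = - (\<Sum>k<i. C i k - C i (Suc k))"
      unfolding sum_negf[symmetric] by (intro sum.cong refl) (simp add: s_def)
    also have "\<dots> = C i i - C i 0" by (simp add: sum_lessThan_telescope')
    also have "(\<Sum>k=i..<n. s i k * (C i k - C i (Suc k))) = - (\<Sum>k=i..<n. C i (Suc k) - C i k)"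
      unfolding sum_negf[symmetric] by (intro sum.cong refl) (simp add: s_def)
    also have "\<dots> = C i i - C i n" using i by (simp add: sum_Suc_diff')
    also have "C i n = - C i 0"
      using cos_periodic_pi[of "\<theta> 0 - \<theta> i"] by (simp add: C_def last algebra_simps)
    also have "C i i = 1" by (simp add: C_def)
    finally show ?thesis by simp
  qed
  have sin_nonneg: "sin (\<alpha> k) \<ge> 0" if "k < n" for k
  proof -
    have "\<theta> 0 \<le> \<theta> k" "\<theta> k \<le> \<theta> (Suc k)" "\<theta> (Suc k) \<le> \<theta> n" using that by (auto intro!: mono)
    thus ?thesis using last pi_gt_zero unfolding \<alpha>_def by (intro sin_ge_zero) auto
  qed
  have "2 * real n = (\<Sum>i<n. \<Sum>k<n. s i k * (C i k - C i (Suc k)))" using row by simp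
  also have "\<dots> = (\<Sum>k<n. \<Sum>i<n. s i k * (C i k - C i (Suc k)))" by (rule sum.swap)
  also have "\<dots> = (\<Sum>k<n. 2 * sin (\<alpha> k) * (\<Sum>i<n. s i k * sin (m k - \<theta> i)))"
    unfolding sum_distrib_left prod[symmetric] by (simp add: mult_ac)
  also have "\<dots> \<le> (\<Sum>k<n. 2 * sin (\<alpha> k) * R)"
  proof (intro sum_mono mult_left_mono)
    fix k assume k: "k \<in> {..<n}"
    have "(\<Sum>i<n. s i k * sin (m k - \<theta> i)) \<le> (\<Sum>i<n. \<bar>sin (m k - \<theta> i)\<bar>)"
      by (intro sum_mono) (auto simp: s_def)
    also have "\<dots> \<le> R" by (rule R)
    finally show "(\<Sum>i<n. s i k * sin (m k - \<theta> i)) \<le> R" .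
    show "0 \<le> 2 * sin (\<alpha> k)" using sin_nonneg k by simp
  qed
  also have "\<dots> = 2 * (R * (\<Sum>k<n. sin (\<alpha> k)))"
    by (simp add: sum_distrib_left mult_ac)
  finally show ?thesis by (simp add: \<alpha>_def)
qed

text \<open>
  Strict concavity of the sine on \<open>[0, pi]\<close>: by the mean value theorem the slope of a chord
  from \<open>c\<close> is the cosine of a point strictly between, and the cosine decreases.
\<close>
lemma sin_less_tangent:
  assumes "0 \<le> x" "x \<le> pi" "0 \<le> c" "c \<le> pi" "x \<noteq> c"
  shows "sin x < sin c + cos c * (x - c)"
proof (cases "x > c")
  case True
  obtain z where z: "c < z" "z < x" "sin x - sin c = (x - c) * cos z"
    using MVT2[OF True, of sin cos] by auto
  have "cos z < cos c" using z assms by (intro cos_monotone_0_pi) auto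
  hence "(x - c) * cos z < (x - c) * cos c" using True by simp
  thus ?thesis using z(3) unfolding mult.commute[of "cos c"] by linarith
next
  case False
  hence lt: "x < c" using assms by simp
  obtain z where z: "x < z" "z < c" "sin c - sin x = (c - x) * cos z"
    using MVT2[OF lt, of sin cos] by auto
  have "cos c < cos z" using z assms by (intro cos_monotone_0_pi) auto
  hence "(c - x) * cos c < (c - x) * cos z" using lt by simp
  thus ?thesis using z by (simp add: algebra_simps)
qed

text \<open>
  Jensen's inequality with its equality case, obtained by summing the tangent at the mean \<open>c\<close>,
  whose linear terms cancel.
\<close>
lemma sum_sin_jensen:
  assumes x: "\<And>k. k < n \<Longrightarrow> 0 \<le> x k \<and> x k \<le> pi"
    and c: "0 \<le> c" "c \<le> pi" and mean: "(\<Sum>k<n. x k) = real n * c"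
  shows "(\<Sum>k<n. sin (x k)) \<le> real n * sin c"
    and "real n * sin c \<le> (\<Sum>k<n. sin (x k)) \<Longrightarrow> k < n \<Longrightarrow> x k = c"
proof -
  have le: "sin (x k) \<le> sin c + cos c * (x k - c)" if "k < n" for k
    using sin_less_tangent[of "x k" c] x[OF that] c by (cases "x k = c") auto
  have tangents: "(\<Sum>k<n. sin c + cos c * (x k - c)) = real n * sin c"
    by (simp add: sum.distrib sum_subtractf mean flip: sum_distrib_left)
  show "(\<Sum>k<n. sin (x k)) \<le> real n * sin c"
    unfolding tangents[symmetric] using le by (intro sum_mono) simp
  assume ge: "real n * sin c \<le> (\<Sum>k<n. sin (x k))" and k: "k < n"
  show "x k = c"
  proof (rule ccontr)
    assume "x k \<noteq> c"
    hence "sin (x k) < sin c + cos c * (x k - c)"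
      using sin_less_tangent[of "x k" c] x[OF k] c by auto
    hence "(\<Sum>k<n. sin (x k)) < (\<Sum>k<n. sin c + cos c * (x k - c))"
      using le k by (intro sum_strict_mono_ex1) auto
    thus False using ge tangents by simp
  qed
qed

text \<open>
  Sorting the angles is a permutation of the vectors. The extra angle \<open>\<theta> n\<close> is the first one
  after a half turn, so that the \<open>n\<close> gaps add up to \<open>pi\<close>.
\<close>
lemma sorted_angles:
  fixes u :: "nat \<Rightarrow> real ^ 2"
  assumes n: "n \<ge> 1" and u: "u \<in> configs n"
  obtains \<sigma> \<theta> where "\<sigma> permutes {..<n}"
    "\<And>i j. i \<le> j \<Longrightarrow> j \<le> n \<Longrightarrow> \<theta> i \<le> \<theta> j" "\<theta> n = \<theta> 0 + pi"
    "\<And>i. i < n \<Longrightarrow> u (\<sigma> i) = dir (\<theta> i) \<or> u (\<sigma> i) = - dir (\<theta> i)"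
proof -
  have "\<exists>t. 0 \<le> t \<and> t < pi \<and> (u i = dir t \<or> u i = - dir t)" if "i < n" for i
    using norm_1_imp_half_dir[OF configs_norm[OF u that]] by metis
  then obtain \<tau> where \<tau>: "\<And>i. i < n \<Longrightarrow> 0 \<le> \<tau> i \<and> \<tau> i < pi \<and> (u i = dir (\<tau> i) \<or> u i = - dir (\<tau> i))"
    by metis
  define xs where "xs = map \<tau> [0..<n]"
  obtain \<sigma> where \<sigma>: "\<sigma> permutes {..<n}" "permute_list \<sigma> xs = sort xs"
    using mset_eq_permutation[of "sort xs" xs] by (auto simp: xs_def)
  have \<sigma>_less: "\<sigma> i < n" if "i < n" for i
    using permutes_in_image[OF \<sigma>(1)] that by simp
  have nth: "sort xs ! i = \<tau> (\<sigma> i)" if "i < n" for i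
    using \<sigma> that \<sigma>_less[OF that] permute_list_nth[of \<sigma> xs i] by (simp add: xs_def)
  \<comment> \<open>Angles in \<open>[0, pi)\<close> never exceed the last one, which is at least \<open>pi\<close>.\<close>
  define \<theta> where "\<theta> i = (if i < n then \<tau> (\<sigma> i) else \<tau> (\<sigma> 0) + pi)" for i
  show thesis
  proof
    show "\<sigma> permutes {..<n}" by fact
    show "\<theta> n = \<theta> 0 + pi" using n by (simp add: \<theta>_def)
    show "u (\<sigma> i) = dir (\<theta> i) \<or> u (\<sigma> i) = - dir (\<theta> i)" if "i < n" for i
      using \<tau>[OF \<sigma>_less[OF that]] that by (simp add: \<theta>_def)
    show "\<theta> i \<le> \<theta> j" if ij: "i \<le> j" "j \<le> n" for i j
    proof (cases "j < n")
      case True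
      have "sort xs ! i \<le> sort xs ! j"
        using ij True by (intro sorted_nth_mono) (auto simp: xs_def)
      thus ?thesis using True ij nth by (simp add: \<theta>_def)
    next
      case False
      have "\<tau> (\<sigma> 0) \<ge> 0" using \<tau>[OF \<sigma>_less[of 0]] n by simp
      moreover have "\<tau> (\<sigma> i) < pi" if "i < n" using \<tau>[OF \<sigma>_less[OF that]] by simp
      ultimately show ?thesis using False by (auto simp: \<theta>_def)
    qed
  qed
qed

text \<open>
  With \<open>c = pi / (2 * n)\<close>, the half gaps have mean \<open>c\<close>, so
  \<open>n \<le> energy n u * (sum of the sines of the half gaps) \<le> energy n u * n * sin c\<close>. Energy
  \<open>1 / sin c\<close> is the equality case of Jensen's inequality, in which all half gaps are \<open>c\<close>.
\<close>
lemma planar_energy_lower_bound: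
  fixes u :: "nat \<Rightarrow> real ^ 2"
  assumes n: "n \<ge> 1" and u: "u \<in> configs n"
  shows "1 / sin (pi / (2 * real n)) \<le> energy n u"
    and "energy n u \<le> 1 / sin (pi / (2 * real n)) \<Longrightarrow> evenly_spaced n u"
proof -
  obtain \<sigma> \<theta> where \<sigma>: "\<sigma> permutes {..<n}"
    and mono: "\<And>i j. i \<le> j \<Longrightarrow> j \<le> n \<Longrightarrow> \<theta> i \<le> \<theta> j" and last: "\<theta> n = \<theta> 0 + pi"
    and dir: "\<And>i. i < n \<Longrightarrow> u (\<sigma> i) = dir (\<theta> i) \<or> u (\<sigma> i) = - dir (\<theta> i)"
    using sorted_angles[OF n u] by blast
  define c where "c = pi / (2 * real n)"
  define x where "x k = (\<theta> (Suc k) - \<theta> k) / 2" for k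
  have c: "0 < c" "c < pi" using n by (auto simp: c_def field_simps)
  hence sin_c: "sin c > 0" by (intro sin_gt_zero) auto
  \<comment> \<open>Testing in the direction at a right angle to \<open>dir t\<close> turns inner products into sines.\<close>
  have "(\<Sum>i<n. \<bar>sin (t - \<theta> i)\<bar>) \<le> energy n u" for t
  proof -
    have "(\<Sum>i<n. \<bar>sin (t - \<theta> i)\<bar>) = (\<Sum>i<n. \<bar>u (\<sigma> i) \<bullet> dir (t + pi / 2)\<bar>)"
    proof (intro sum.cong refl)
      fix i assume "i \<in> {..<n}"
      hence "\<bar>u (\<sigma> i) \<bullet> dir (t + pi / 2)\<bar> = \<bar>dir (\<theta> i) \<bullet> dir (t + pi / 2)\<bar>"
        using dir[of i] by auto
      also have "dir (\<theta> i) \<bullet> dir (t + pi / 2) = cos ((\<theta> i - t) - pi / 2)"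
        by (simp add: inner_dir algebra_simps)
      also have "\<dots> = - sin (t - \<theta> i)" by (simp add: cos_diff sin_diff)
      finally show "\<bar>sin (t - \<theta> i)\<bar> = \<bar>u (\<sigma> i) \<bullet> dir (t + pi / 2)\<bar>" by simp
    qed
    also have "\<dots> = (\<Sum>i<n. \<bar>u i \<bullet> dir (t + pi / 2)\<bar>)"
      using sum.permute[OF \<sigma>, of "\<lambda>i. \<bar>u i \<bullet> dir (t + pi / 2)\<bar>"] by (simp add: o_def)
    also have "\<dots> \<le> energy n u" by (rule sum_le_energy) simp
    finally show ?thesis .
  qed
  hence main: "real n \<le> energy n u * (\<Sum>k<n. sin (x k))"
    unfolding x_def by (intro count_le_bound_times_sum_sin_half_gaps mono last) auto
  have x: "0 \<le> x k \<and> x k \<le> pi" if "k < n" for k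
  proof -
    have "\<theta> 0 \<le> \<theta> k" "\<theta> k \<le> \<theta> (Suc k)" "\<theta> (Suc k) \<le> \<theta> n" using that by (auto intro!: mono)
    thus ?thesis using last pi_gt_zero unfolding x_def by auto
  qed
  have mean: "(\<Sum>k<n. x k) = real n * c"
    using n by (simp add: x_def c_def last sum_lessThan_telescope flip: sum_divide_distrib)
  have "energy n u * (\<Sum>k<n. sin (x k)) \<le> energy n u * (real n * sin c)"
    by (intro mult_left_mono sum_sin_jensen(1) x mean energy_nonneg) (use c in auto)
  hence "real n * 1 \<le> real n * (energy n u * sin c)" using main by (simp add: mult_ac)
  hence "1 \<le> energy n u * sin c" using n by (subst (asm) mult_le_cancel_left_pos) auto
  thus "1 / sin (pi / (2 * real n)) \<le> energy n u"
    unfolding c_def[symmetric] using sin_c by (simp add: field_simps)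
  assume "energy n u \<le> 1 / sin (pi / (2 * real n))"
  hence E: "energy n u \<le> 1 / sin c" by (simp add: c_def)
  have "(\<Sum>k<n. sin (x k)) \<ge> 0" using x by (intro sum_nonneg sin_ge_zero) auto
  hence "real n \<le> 1 / sin c * (\<Sum>k<n. sin (x k))"
    using main mult_right_mono[OF E] by (meson order_trans)
  hence "real n * sin c \<le> (\<Sum>k<n. sin (x k))" using sin_c by (simp add: field_simps)
  hence xc: "x k = c" if "k < n" for k
    using sum_sin_jensen(2)[OF x _ _ mean] c that by auto
  have "\<theta> k = \<theta> 0 + real k * pi / real n" if "k \<le> n" for k
    using that
  proof (induction k)
    case (Suc k)
    have "\<theta> (Suc k) = \<theta> k + 2 * c" using xc[of k] Suc.prems by (simp add: x_def)
    thus ?case using Suc n by (simp add: c_def field_simps)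
  qed simp
  hence "u (\<sigma> i) = dir (\<theta> 0 + real i * pi / real n) \<or> u (\<sigma> i) = - dir (\<theta> 0 + real i * pi / real n)"
    if "i < n" for i using dir[OF that] that by (metis less_imp_le)
  thus "evenly_spaced n u" by (rule evenly_spacedI[OF n \<sigma>])
qed

section \<open>Four vectors in space\<close>

lemma sum_lessThan_4: "(\<Sum>i<4. f i) = f 0 + f 1 + f 2 + f (3::nat)"
  for f :: "nat \<Rightarrow> 'a::comm_monoid_add"
  by (simp add: eval_nat_numeral add.assoc)

lemma all_less_4: "(\<forall>i<4. P i) \<longleftrightarrow> P 0 \<and> P 1 \<and> P 2 \<and> P (3::nat)"
  by (auto simp: eval_nat_numeral less_Suc_eq)

text \<open>
  The coefficients form a null vector of the matrix with columns \<open>u 0, \<dots>, u 3\<close>, which has rank at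
  most \<open>3\<close>. Working with columns instead of a set of vectors allows the \<open>u i\<close> to coincide.
\<close>
lemma exists_null_vector:
  fixes u :: "nat \<Rightarrow> real ^ 3"
  shows "\<exists>y. (\<exists>i<4. y i \<noteq> 0) \<and> (\<Sum>i<4. y i *\<^sub>R u i) = 0"
proof -
  define A :: "real ^ 4 ^ 3" where
    "A = (\<chi> r c. u (if c = 1 then 0 else if c = 2 then 1 else if c = 3 then 2 else 3) $ r)"
  have "rank A \<le> min CARD(3) CARD(4)" by (rule rank_bound)
  hence "rank A \<noteq> CARD(4)" by simp
  then obtain x where x: "x \<noteq> 0" "A *v x = 0"
    using matrix_nonfull_linear_equations_eq[of A] by blast
  define y where "y i = (if i = 0 then x $ 1 else if i = 1 then x $ 2 else if i = 2 then x $ 3 else x $ 4)"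
    for i :: nat
  have "(\<Sum>i<4. y i *\<^sub>R u i) = A *v x"
    by (simp add: sum_lessThan_4 y_def A_def vec_eq_iff matrix_vector_mult_def sum_4 mult.commute)
  moreover have "\<exists>i<4. y i \<noteq> 0"
  proof (rule ccontr)
    assume "\<not> ?thesis"
    hence "\<forall>i<4. y i = 0" by blast
    hence "x = 0" by (simp add: all_less_4 y_def vec_eq_iff forall_4)
    thus False using x by simp
  qed
  ultimately show ?thesis using x by auto
qed

text \<open>
  Flipping vectors makes the coefficients of a dependency nonnegative, a transposition puts the
  smallest coefficient first, and scaling makes the coefficient vector a unit vector.
\<close>
lemma normalised_null_vector:
  fixes u :: "nat \<Rightarrow> real ^ 3"
  obtains \<sigma> s x where "\<sigma> permutes {..<4::nat}" "\<And>i. s i \<in> {1, - 1 :: real}"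
    "\<And>i. i < 4 \<Longrightarrow> 0 \<le> x 0 \<and> x 0 \<le> (x i :: real)" "(\<Sum>i<4. (x i)\<^sup>2) = 1"
    "(\<Sum>i<4. x i *\<^sub>R s i *\<^sub>R u (\<sigma> i)) = 0"
proof -
  obtain y where y: "\<exists>i<4. y i \<noteq> 0" "(\<Sum>i<4. y i *\<^sub>R u i) = 0"
    using exists_null_vector by blast
  define N where "N = (\<Sum>i<4. (y i)\<^sup>2)"
  obtain i where "i < 4" "y i \<noteq> 0" using y by blast
  hence N: "N > 0" unfolding N_def by (intro sum_pos2[of _ i]) auto
  obtain m where m: "m < 4" "\<And>i. i < 4 \<Longrightarrow> \<bar>y m\<bar> \<le> \<bar>y i\<bar>"
    using ex_min_if_finite[of "(\<lambda>i. \<bar>y i\<bar>) ` {..<4::nat}"]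
    by (auto simp: not_less lessThan_empty_iff)
  define \<sigma> where "\<sigma> = Transposition.transpose 0 m"
  have \<sigma>: "\<sigma> permutes {..<4::nat}" unfolding \<sigma>_def using m by (intro permutes_swap_id) auto
  define x where "x i = \<bar>y (\<sigma> i)\<bar> / sqrt N" for i
  define s :: "nat \<Rightarrow> real" where "s i = (if y (\<sigma> i) \<ge> 0 then 1 else - 1)" for i
  show thesis
  proof
    show "\<sigma> permutes {..<4}" by fact
    show "s i \<in> {1, - 1}" for i by (simp add: s_def)
    show "0 \<le> x 0 \<and> x 0 \<le> x i" if "i < 4" for i
    proof -
      have "\<sigma> i < 4" using permutes_in_image[OF \<sigma>] that by simp
      moreover have "\<sigma> 0 = m" by (simp add: \<sigma>_def)
      ultimately show ?thesis using m N by (simp add: x_def divide_right_mono)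
    qed
    have "(\<Sum>i<4. (x i)\<^sup>2) = (\<Sum>i<4. (y (\<sigma> i))\<^sup>2) / N"
      using N by (simp add: x_def power_divide sum_divide_distrib)
    also have "(\<Sum>i<4. (y (\<sigma> i))\<^sup>2) = N"
      using sum.permute[OF \<sigma>, of "\<lambda>i. (y i)\<^sup>2"] by (simp add: N_def o_def)
    finally show "(\<Sum>i<4. (x i)\<^sup>2) = 1" using N by simp
    have "(\<Sum>i<4. x i *\<^sub>R s i *\<^sub>R u (\<sigma> i)) = (\<Sum>i<4. (1 / sqrt N) *\<^sub>R (y (\<sigma> i) *\<^sub>R u (\<sigma> i)))"
      by (intro sum.cong refl) (auto simp: x_def s_def)
    also have "\<dots> = (1 / sqrt N) *\<^sub>R (\<Sum>i<4. y (\<sigma> i) *\<^sub>R u (\<sigma> i))"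
      by (simp only: scaleR_sum_right)
    also have "(\<Sum>i<4. y (\<sigma> i) *\<^sub>R u (\<sigma> i)) = 0"
      using sum.permute[OF \<sigma>, of "\<lambda>i. y i *\<^sub>R u i"] y by (simp add: o_def)
    finally show "(\<Sum>i<4. x i *\<^sub>R s i *\<^sub>R u (\<sigma> i)) = 0" by simp
  qed
qed

text \<open>
  Let \<open>v 0, v 1, v 2, v 3\<close> be unit vectors with Gram matrix entries \<open>g01\<close>, ..., \<open>g23\<close> and
  \<open>w v 0 + x v 1 + y v 2 + z v 3 = 0\<close>. The value bounded by \<open>M\<close> is the squared norm \<open>G\<close> of
  \<open>v 0 + a v 1 + b v 2 + c v 3\<close>, and the assumption \<open>null\<close> says that the dependency has
  squared norm \<open>0\<close>.

  The idea is to average \<open>G\<close> over the eight sign patterns with weights \<open>L / 8\<close> under which each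
  product of two signs has as its mean minus the product of the two coefficients. This turns the
  mean of \<open>G\<close> into \<open>4\<close> minus twice the left-hand side of \<open>null\<close>, which is \<open>5\<close>. These means determine the
  weights except for the coefficient of the product \<open>a b c\<close> of all four signs; with
  \<open>w * (x + y + z)\<close> for it, the two smallest values of \<open>L\<close>, those for \<open>a = b = c\<close>, both equal
  \<open>K / 2 \<ge> 0\<close>. So \<open>5 \<le> M\<close>.

  For the equality case, \<open>K / 2\<close> is split off from every \<open>L\<close>. The uniform average of \<open>G\<close> is
  \<open>4\<close>, so \<open>M = 5\<close> forces \<open>K = 0\<close>; and \<open>K\<close> is a sum of squares vanishing only for
  \<open>w = 0\<close> and \<open>x = y = z\<close>.
\<close>
lemma weighted_sign_average:
  fixes w x y z M g01 g02 g03 g12 g13 g23 :: real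
  defines "K \<equiv> 3 - (x + y + z)\<^sup>2 - w\<^sup>2"
  assumes nonneg: "0 \<le> w" "w \<le> x" "w \<le> y" "w \<le> z"
    and unit: "w\<^sup>2 + x\<^sup>2 + y\<^sup>2 + z\<^sup>2 = 1"
    and null: "w * x * g01 + w * y * g02 + w * z * g03 + x * y * g12 + x * z * g13 + y * z * g23 = - 1 / 2"
    and bound: "\<And>a b c :: real. \<lbrakk>a \<in> {1, - 1}; b \<in> {1, - 1}; c \<in> {1, - 1}\<rbrakk> \<Longrightarrow>
      4 + 2 * (a * g01 + b * g02 + c * g03 + a * b * g12 + a * c * g13 + b * c * g23) \<le> M"
  shows "2 * (M - 5) \<ge> K * (M - 4)" and "M \<ge> 4" and "K \<ge> 0"
    and "K = 0 \<Longrightarrow> w = 0 \<and> x = y \<and> y = z"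
proof -
  define G where "G a b c = 4 + 2 * (a * g01 + b * g02 + c * g03 + a * b * g12 + a * c * g13 + b * c * g23)"
    for a b c :: real
  define L where "L a b c = 1 - (a * (w * x) + b * (w * y) + c * (w * z) + a * b * (x * y) + a * c * (x * z) + b * c * (y * z))
      + a * b * c * (w * (x + y + z))"
    for a b c :: real
  have K: "K = 2 * w\<^sup>2 + (x - y)\<^sup>2 + (y - z)\<^sup>2 + (z - x)\<^sup>2"
  proof -
    have "K = 3 * (w\<^sup>2 + x\<^sup>2 + y\<^sup>2 + z\<^sup>2) - (x + y + z)\<^sup>2 - w\<^sup>2" by (simp add: K_def unit)
    also have "\<dots> = 2 * w\<^sup>2 + (x - y)\<^sup>2 + (y - z)\<^sup>2 + (z - x)\<^sup>2"
      by (simp add: power2_eq_square algebra_simps)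
    finally show ?thesis .
  qed
  show "K \<ge> 0" unfolding K by simp
  have prods: "0 \<le> w * x" "0 \<le> w * y" "0 \<le> w * z" "w * x \<le> y * x" "w * x \<le> z * x" "w * y \<le> x * y"
    "w * y \<le> z * y" "w * z \<le> x * z" "w * z \<le> y * z"
    using nonneg by (auto intro: mult_right_mono)
  have L: "L a b c \<ge> K / 2" if "a \<in> {1, - 1}" "b \<in> {1, - 1}" "c \<in> {1, - 1}" for a b c
  proof -
    have "K / 2 = 1 + (w\<^sup>2 + x\<^sup>2 + y\<^sup>2 + z\<^sup>2) / 2 - (x + y + z)\<^sup>2 / 2 - w\<^sup>2 / 2"
      by (simp add: K_def unit diff_divide_distrib)
    also have "\<dots> = 1 - (x * y + x * z + y * z)" by (simp add: power2_eq_square field_simps)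
    finally show ?thesis
      using that prods by (auto simp: L_def algebra_simps)
  qed
  \<comment> \<open>Expanded and added up over all signs, these products leave only the products of matching
    sign monomials.\<close>
  have "0 \<le> (L a b c - K / 2) * (M - G a b c)" if "a \<in> {1, - 1}" "b \<in> {1, - 1}" "c \<in> {1, - 1}" for a b c
    using L[OF that] bound[OF that] by (simp add: G_def)
  from this[of 1 1 1] this[of 1 1 "- 1"] this[of 1 "- 1" 1] this[of 1 "- 1" "- 1"]
    this[of "- 1" 1 1] this[of "- 1" 1 "- 1"] this[of "- 1" "- 1" 1] this[of "- 1" "- 1" "- 1"]
  have "0 \<le> (L 1 1 1 - K / 2) * (M - G 1 1 1) + (L 1 1 (- 1) - K / 2) * (M - G 1 1 (- 1))
    + (L 1 (- 1) 1 - K / 2) * (M - G 1 (- 1) 1) + (L 1 (- 1) (- 1) - K / 2) * (M - G 1 (- 1) (- 1))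
    + (L (- 1) 1 1 - K / 2) * (M - G (- 1) 1 1) + (L (- 1) 1 (- 1) - K / 2) * (M - G (- 1) 1 (- 1))
    + (L (- 1) (- 1) 1 - K / 2) * (M - G (- 1) (- 1) 1)
    + (L (- 1) (- 1) (- 1) - K / 2) * (M - G (- 1) (- 1) (- 1))" by simp
  also have "\<dots> = 8 * M - 32
      + 16 * (w * x * g01 + w * y * g02 + w * z * g03 + x * y * g12 + x * z * g13 + y * z * g23)
      - 4 * (K * (M - 4))"
    unfolding L_def G_def by algebra
  finally show "2 * (M - 5) \<ge> K * (M - 4)" unfolding null by simp
  show "M \<ge> 4"
    using bound[of 1 1 1] bound[of 1 1 "- 1"] bound[of 1 "- 1" 1] bound[of 1 "- 1" "- 1"]
      bound[of "- 1" 1 1] bound[of "- 1" 1 "- 1"] bound[of "- 1" "- 1" 1] bound[of "- 1" "- 1" "- 1"]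
    by simp
  assume "K = 0"
  moreover have "0 \<le> w\<^sup>2" "0 \<le> (x - y)\<^sup>2" "0 \<le> (y - z)\<^sup>2" "0 \<le> (z - x)\<^sup>2" by simp_all
  ultimately have "w\<^sup>2 = 0" "(x - y)\<^sup>2 = 0" "(y - z)\<^sup>2 = 0" using K by linarith+
  thus "w = 0 \<and> x = y \<and> y = z" by simp
qed

text \<open>
  The triangular pyramid without a frame: unit vectors with sum \<open>0\<close> have mutual inner products
  \<open>- 1 / 2\<close>, so they form an equilateral triangle in a plane, and \<open>w 0\<close> is normal to it.
\<close>
definition pyramid :: "(nat \<Rightarrow> real ^ 3) \<Rightarrow> bool" where
  "pyramid w \<longleftrightarrow> w 1 + w 2 + w 3 = 0 \<and> w 0 \<bullet> w 1 = 0 \<and> w 0 \<bullet> w 2 = 0 \<and> w 0 \<bullet> w 3 = 0"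

text \<open>
  The signed sums of the \<open>v i\<close> satisfy the hypotheses of \<open>weighted_sign_average\<close> with
  \<open>M = (energy 4 v)\<^sup>2\<close>. If \<open>M = 5\<close>, the dependency reduces to \<open>v 1 + v 2 + v 3 = 0\<close>; then
  \<open>v 1 + v 2 - v 3 = - 2 v 3\<close>, so \<open>norm (v 0 \<plusminus> 2 v 3) \<le> sqrt 5\<close> for both signs forces
  \<open>v 0 \<bullet> v 3 = 0\<close>, and likewise for \<open>v 1\<close> and \<open>v 2\<close>.
\<close>
lemma four_vectors_energy_bound:
  fixes v :: "nat \<Rightarrow> real ^ 3"
  assumes v: "v \<in> configs 4" and x: "\<And>i. i < 4 \<Longrightarrow> 0 \<le> x 0 \<and> x 0 \<le> (x i :: real)"
    and unit: "(\<Sum>i<4. (x i)\<^sup>2) = 1" and null: "(\<Sum>i<4. x i *\<^sub>R v i) = 0"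
  shows "sqrt 5 \<le> energy 4 v" and "energy 4 v \<le> sqrt 5 \<Longrightarrow> pyramid v"
proof -
  define g where "g i j = v i \<bullet> v j" for i j
  define M where "M = (energy 4 v)\<^sup>2"
  have diag: "v i \<bullet> v i = 1" if "i < 4" for i
    using configs_norm[OF v that] by (simp add: dot_square_norm)
  have bound: "4 + 2 * (a * g 0 1 + b * g 0 2 + c * g 0 3 + a * b * g 1 2 + a * c * g 1 3 + b * c * g 2 3) \<le> M"
    if abc: "a \<in> {1, - 1}" "b \<in> {1, - 1}" "c \<in> {1, - 1}" for a b c :: real
  proof -
    define e where "e i = (if i = 0 then 1 else if i = 1 then a else if i = 2 then b else c)" for i :: nat
    have "norm (\<Sum>i<4. e i *\<^sub>R v i) \<le> energy 4 v"
      by (rule norm_signed_sum_le_energy) (use abc in \<open>auto simp: e_def\<close>)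
    hence "(norm (\<Sum>i<4. e i *\<^sub>R v i))\<^sup>2 \<le> M" unfolding M_def by (intro power_mono) auto
    also have "(norm (\<Sum>i<4. e i *\<^sub>R v i))\<^sup>2
        = 1 + a * a + b * b + c * c
          + 2 * (a * g 0 1 + b * g 0 2 + c * g 0 3 + a * b * g 1 2 + a * c * g 1 3 + b * c * g 2 3)"
      unfolding power2_norm_eq_inner
      by (simp add: sum_lessThan_4 e_def inner_add_left inner_add_right diag g_def inner_commute algebra_simps)
    finally show ?thesis using abc by auto
  qed
  have "0 = (\<Sum>i<4. x i *\<^sub>R v i) \<bullet> (\<Sum>i<4. x i *\<^sub>R v i)" by (simp add: null)
  also have "\<dots> = (\<Sum>i<4. (x i)\<^sup>2) + 2 * (x 0 * x 1 * g 0 1 + x 0 * x 2 * g 0 2 + x 0 * x 3 * g 0 3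
      + x 1 * x 2 * g 1 2 + x 1 * x 3 * g 1 3 + x 2 * x 3 * g 2 3)"
    by (simp add: sum_lessThan_4 inner_add_left inner_add_right diag g_def inner_commute
        power2_eq_square algebra_simps)
  finally have rel: "x 0 * x 1 * g 0 1 + x 0 * x 2 * g 0 2 + x 0 * x 3 * g 0 3
      + x 1 * x 2 * g 1 2 + x 1 * x 3 * g 1 3 + x 2 * x 3 * g 2 3 = - 1 / 2"
    using unit by simp
  have unit': "(x 0)\<^sup>2 + (x 1)\<^sup>2 + (x 2)\<^sup>2 + (x 3)\<^sup>2 = 1" using unit by (simp add: sum_lessThan_4)
  have x': "0 \<le> x 0" "x 0 \<le> x 1" "x 0 \<le> x 2" "x 0 \<le> x 3"
    using x[of 0] x[of 1] x[of 2] x[of 3] by simp_all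
  define K where "K = 3 - (x 1 + x 2 + x 3)\<^sup>2 - (x 0)\<^sup>2"
  have avg: "K * (M - 4) \<le> 2 * (M - 5)" "4 \<le> M" "0 \<le> K"
    "K = 0 \<Longrightarrow> x 0 = 0 \<and> x 1 = x 2 \<and> x 2 = x 3"
    unfolding K_def by (rule weighted_sign_average[OF x' unit' rel]; use bound in blast)+
  have "0 \<le> K * (M - 4)" using avg(2,3) by (intro mult_nonneg_nonneg) auto
  hence "0 \<le> 2 * (M - 5)" using avg(1) by (rule order_trans)
  hence "M \<ge> 5" by simp
  hence "sqrt 5 \<le> sqrt M" by simp
  thus "sqrt 5 \<le> energy 4 v" using energy_nonneg[of 4 v] by (simp add: M_def)
  assume "energy 4 v \<le> sqrt 5"
  hence "M \<le> (sqrt 5)\<^sup>2" unfolding M_def using energy_nonneg by (intro power_mono)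
  with \<open>M \<ge> 5\<close> have M: "M = 5" by simp
  hence "K = 0" using avg(1,3) by simp
  hence eq: "x 0 = 0" "x 1 = x 3" "x 2 = x 3" using avg(4) by auto
  hence "x 3 \<noteq> 0" using unit' by auto
  have "x 3 *\<^sub>R (v 1 + v 2 + v 3) = 0"
    using null eq by (simp add: sum_lessThan_4 scaleR_add_right)
  with \<open>x 3 \<noteq> 0\<close> have sum0: "v 1 + v 2 + v 3 = 0" by simp
  have "v i \<bullet> (v 1 + v 2 + v 3) = 0" for i by (simp only: sum0 inner_zero_right)
  from this[of 0] this[of 1] this[of 2] this[of 3]
  have G: "g 0 1 + g 0 2 + g 0 3 = 0" "1 + g 1 2 + g 1 3 = 0" "g 1 2 + 1 + g 2 3 = 0" "g 1 3 + g 2 3 + 1 = 0"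
    by (simp_all add: inner_add_right g_def diag inner_commute)
  hence "g 1 2 = - 1 / 2" "g 1 3 = - 1 / 2" "g 2 3 = - 1 / 2" by auto
  with G M bound[of 1 1 "- 1"] bound[of "- 1" "- 1" 1] bound[of 1 "- 1" 1] bound[of "- 1" 1 "- 1"]
    bound[of "- 1" 1 1] bound[of 1 "- 1" "- 1"]
  have "g 0 1 = 0" "g 0 2 = 0" "g 0 3 = 0" by simp_all
  thus "pyramid v" using sum0 by (simp add: pyramid_def g_def)
qed

text \<open>
  The three equatorial vectors have sum \<open>0\<close>, since the determinant of their Gram matrix,
  \<open>(1 - g)\<^sup>2 * (1 + 2 * g)\<close> for the common inner product \<open>g\<close>, vanishes in a plane. So the three
  values \<open>w i \<bullet> v\<close> add up to \<open>0\<close>, and the sum of their absolute values is twice the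
  largest one, hence at most \<open>2 * r\<close> for the length \<open>r\<close> of the horizontal part of \<open>v\<close>. Finally
  \<open>\<bar>v $ 3\<bar> + 2 * r \<le> sqrt 5\<close> by the Cauchy--Schwarz inequality.
\<close>
lemma sum_abs_inner_le_if_pole_and_triangle:
  fixes w :: "nat \<Rightarrow> real ^ 3"
  assumes w: "w \<in> configs 4" and pole: "w 0 \<in> {axis 3 1, - axis 3 1}"
    and equ: "w 1 \<in> equator" "w 2 \<in> equator" "w 3 \<in> equator"
    and tri: "equilateral_triangle (w 1) (w 2) (w 3)"
    and v: "norm v = 1"
  shows "(\<Sum>i<4. \<bar>w i \<bullet> v\<bar>) \<le> sqrt 5"
proof -
  have ip: "x \<bullet> y = x $ 1 * y $ 1 + x $ 2 * y $ 2 + x $ 3 * y $ 3" for x y :: "real ^ 3"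
    by (simp add: inner_vec_def sum_3)
  have third: "w 1 $ 3 = 0" "w 2 $ 3 = 0" "w 3 $ 3 = 0" using equ by (auto simp: equator_def)
  have sq: "w 1 \<bullet> w 1 = 1" "w 2 \<bullet> w 2 = 1" "w 3 \<bullet> w 3 = 1"
    using configs_norm[OF w] by (simp_all add: dot_square_norm)
  have dist2: "(dist a b)\<^sup>2 = a \<bullet> a + b \<bullet> b - 2 * (a \<bullet> b)" for a b :: "real ^ 3"
    by (simp only: dist_norm power2_norm_eq_inner) (simp add: inner_diff_left inner_diff_right inner_commute)
  define g where "g = w 1 \<bullet> w 2"
  have "(dist (w 1) (w 2))\<^sup>2 = (dist (w 2) (w 3))\<^sup>2" "(dist (w 2) (w 3))\<^sup>2 = (dist (w 3) (w 1))\<^sup>2"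
    using tri by (simp_all add: equilateral_triangle_def)
  hence g: "w 2 \<bullet> w 3 = g" "w 3 \<bullet> w 1 = g"
    unfolding dist2 sq by (simp_all add: g_def)
  have "w 1 \<noteq> w 2" using tri unfolding equilateral_triangle_def by (elim conjE)
  hence "(dist (w 1) (w 2))\<^sup>2 \<noteq> 0" by simp
  hence "g \<noteq> 1" unfolding dist2 sq by (simp add: g_def)
  \<comment> \<open>Lagrange's identity for the planar cross product expresses the vanishing Gram determinant.\<close>
  define cr where "cr x y = x $ 1 * y $ 2 - x $ 2 * y $ 1" for x y :: "real ^ 3"
  have lagrange: "cr a b * cr a c = (a \<bullet> a) * (b \<bullet> c) - (a \<bullet> b) * (a \<bullet> c)"
    if "a $ 3 = 0" "b $ 3 = 0" for a b c :: "real ^ 3"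
    using that by (simp add: ip cr_def algebra_simps)
  define p q where "p = cr (w 1) (w 2)" and "q = cr (w 1) (w 3)"
  have w13: "w 1 \<bullet> w 3 = g" using g(2) by (simp only: inner_commute)
  have "p * p = 1 - g * g" "q * q = 1 - g * g" "p * q = g - g * g"
    by (simp_all only: p_def q_def lagrange third sq g w13 g_def[symmetric] mult_1)
  moreover have "(p * q) * (p * q) = (p * p) * (q * q)" by (simp only: mult_ac)
  ultimately have "(g - g * g) * (g - g * g) = (1 - g * g) * (1 - g * g)" by (simp only:)
  hence "(1 - g)\<^sup>2 * (1 + 2 * g) = 0" by algebra
  with \<open>g \<noteq> 1\<close> have "g = - 1 / 2" by simp
  hence "(w 1 + w 2 + w 3) \<bullet> (w 1 + w 2 + w 3) = 0"
    using sq g by (simp add: inner_add_left inner_add_right inner_commute g_def)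
  hence sum0: "w 1 + w 2 + w 3 = 0" by simp
  define r where "r = sqrt ((v $ 1)\<^sup>2 + (v $ 2)\<^sup>2)"
  have "v \<bullet> v = 1" using v by (simp add: dot_square_norm)
  hence r: "r\<^sup>2 + (v $ 3)\<^sup>2 = 1" by (simp add: r_def ip power2_eq_square)
  have le: "\<bar>a \<bullet> v\<bar> \<le> r" if "a \<bullet> a = 1" "a $ 3 = 0" for a :: "real ^ 3"
  proof -
    have "(a \<bullet> v)\<^sup>2 + (a $ 1 * v $ 2 - a $ 2 * v $ 1)\<^sup>2 = (a \<bullet> a) * ((v $ 1)\<^sup>2 + (v $ 2)\<^sup>2)"
      using that(2) by (simp add: ip power2_eq_square algebra_simps)
    hence "(a \<bullet> v)\<^sup>2 + (a $ 1 * v $ 2 - a $ 2 * v $ 1)\<^sup>2 = (v $ 1)\<^sup>2 + (v $ 2)\<^sup>2"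
      by (simp add: that(1))
    hence "(a \<bullet> v)\<^sup>2 \<le> (v $ 1)\<^sup>2 + (v $ 2)\<^sup>2"
      using zero_le_power2[of "a $ 1 * v $ 2 - a $ 2 * v $ 1"] by linarith
    thus ?thesis unfolding r_def by (metis real_sqrt_abs real_sqrt_le_iff)
  qed
  have "w 1 \<bullet> v + w 2 \<bullet> v + w 3 \<bullet> v = 0" by (metis inner_add_left inner_zero_left sum0)
  with le[OF sq(1) third(1)] le[OF sq(2) third(2)] le[OF sq(3) third(3)]
  have planar: "\<bar>w 1 \<bullet> v\<bar> + \<bar>w 2 \<bullet> v\<bar> + \<bar>w 3 \<bullet> v\<bar> \<le> 2 * r" by linarith
  have "\<bar>w 0 \<bullet> v\<bar> = \<bar>v $ 3\<bar>" using pole by (auto simp: inner_axis inner_commute)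
  moreover have "(\<bar>v $ 3\<bar> + 2 * r)\<^sup>2 + (2 * \<bar>v $ 3\<bar> - r)\<^sup>2 = 5 * (r\<^sup>2 + \<bar>v $ 3\<bar>\<^sup>2)"
    by (simp only: power2_eq_square) (simp add: algebra_simps)
  hence "(\<bar>v $ 3\<bar> + 2 * r)\<^sup>2 \<le> 5"
    using r zero_le_power2[of "2 * \<bar>v $ 3\<bar> - r"] by (simp only: power2_abs)
  hence "\<bar>v $ 3\<bar> + 2 * r \<le> sqrt 5" by (rule real_le_rsqrt)
  ultimately show ?thesis using planar by (simp add: sum_lessThan_4)
qed

text \<open>
  The three kinds of moves permute the values of \<open>v \<mapsto> \<Sum>i<n. \<bar>u i \<bullet> v\<bar>\<close> over the sphere, so they leave
  the energy unchanged.
\<close>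
lemma sum_abs_inner_transformed:
  fixes u :: "nat \<Rightarrow> real ^ 'p" and Q :: "real ^ 'p ^ 'p"
  assumes \<sigma>: "\<sigma> permutes {..<n}" and s: "\<forall>i<n. s i \<in> {1, - 1 :: real}" and Q: "orthogonal_matrix Q"
    and w: "\<forall>i<n. w i = Q *v (s i *\<^sub>R u (\<sigma> i))"
  shows "(\<Sum>i<n. \<bar>w i \<bullet> (Q *v v)\<bar>) = (\<Sum>i<n. \<bar>u i \<bullet> v\<bar>)"
proof -
  have "orthogonal_transformation ((*v) Q)"
    using Q by (simp add: orthogonal_transformation_matrix matrix_vector_mul_linear)
  hence inner: "(Q *v a) \<bullet> (Q *v b) = a \<bullet> b" for a b
    by (simp add: orthogonal_transformation_def)
  have "(\<Sum>i<n. \<bar>w i \<bullet> (Q *v v)\<bar>) = (\<Sum>i<n. \<bar>u (\<sigma> i) \<bullet> v\<bar>)"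
  proof (intro sum.cong refl)
    fix i assume "i \<in> {..<n}"
    hence "i < n" by simp
    hence "w i \<bullet> (Q *v v) = s i * (u (\<sigma> i) \<bullet> v)" "s i \<in> {1, - 1}" using w s by (simp_all add: inner)
    thus "\<bar>w i \<bullet> (Q *v v)\<bar> = \<bar>u (\<sigma> i) \<bullet> v\<bar>" by auto
  qed
  also have "\<dots> = (\<Sum>i<n. \<bar>u i \<bullet> v\<bar>)"
    using sum.permute[OF \<sigma>, of "\<lambda>i. \<bar>u i \<bullet> v\<bar>"] by (simp add: o_def)
  finally show ?thesis .
qed

lemma norm_orthogonal_matrix_mult:
  fixes Q :: "real ^ 'p ^ 'p"
  assumes "orthogonal_matrix Q"
  shows "norm (Q *v v) = norm v"
  using assms by (simp add: orthogonal_transformation_matrix matrix_vector_mul_linear orthogonal_transformation_norm)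

lemma energy_le_if_triangular_pyramid_type:
  assumes u: "u \<in> configs 4" and type: "triangular_pyramid_type u"
  shows "energy 4 u \<le> sqrt 5"
proof (rule energy_leI)
  fix v :: "real ^ 3" assume v: "norm v = 1"
  obtain \<sigma> s Q w where \<sigma>: "\<sigma> permutes {..<4}" and s: "\<forall>i<4. s i \<in> {1, - 1 :: real}"
    and Q: "orthogonal_matrix Q" and w: "\<forall>i<4. w i = Q *v (s i *\<^sub>R u (\<sigma> i))"
    and shape: "w 0 \<in> {axis 3 1, - axis 3 1}" "w 1 \<in> equator" "w 2 \<in> equator" "w 3 \<in> equator"
      "equilateral_triangle (w 1) (w 2) (w 3)"
    using type unfolding triangular_pyramid_type_def by blast
  have "norm (w i) = 1" if "i < 4" for i
  proof -
    have "\<sigma> i < 4" using permutes_in_image[OF \<sigma>] that by simp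
    moreover have "s i \<in> {1, - 1}" using s that by blast
    ultimately show ?thesis
      using w that configs_norm[OF u] by (auto simp: norm_orthogonal_matrix_mult[OF Q])
  qed
  hence "w \<in> configs 4" by (simp add: configs_def)
  from sum_abs_inner_le_if_pole_and_triangle[OF this shape, of "Q *v v"]
  show "(\<Sum>i<4. \<bar>u i \<bullet> v\<bar>) \<le> sqrt 5"
    by (simp add: sum_abs_inner_transformed[OF \<sigma> s Q w] norm_orthogonal_matrix_mult[OF Q] v)
qed

text \<open>
  After the permutation and the sign changes of \<open>normalised_null_vector\<close> the configuration has the
  same energy and \<open>four_vectors_energy_bound\<close> applies. In the equality case an orthogonal map that
  sends the first vector to the pole sends the other three to the equator.
\<close>
lemma spatial_energy_lower_bound:
  fixes u :: "nat \<Rightarrow> real ^ 3"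
  assumes u: "u \<in> configs 4"
  shows "sqrt 5 \<le> energy 4 u" and "energy 4 u \<le> sqrt 5 \<Longrightarrow> triangular_pyramid_type u"
proof -
  obtain \<sigma> s x where \<sigma>: "\<sigma> permutes {..<4::nat}" and s: "\<And>i. s i \<in> {1, - 1 :: real}"
    and x: "\<And>i. i < 4 \<Longrightarrow> 0 \<le> x 0 \<and> x 0 \<le> (x i :: real)" "(\<Sum>i<4. (x i)\<^sup>2) = 1"
      "(\<Sum>i<4. x i *\<^sub>R s i *\<^sub>R u (\<sigma> i)) = 0"
    by (rule normalised_null_vector[of u]) (rule that)
  define v where "v i = s i *\<^sub>R u (\<sigma> i)" for i
  have s1: "\<bar>s i\<bar> = 1" for i using s[of i] by auto
  have norm_v: "norm (v i) = 1" if "i < 4" for i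
    using that permutes_in_image[OF \<sigma>, of i] configs_norm[OF u] s1 by (simp add: v_def)
  hence v: "v \<in> configs 4" by (simp add: configs_def)
  have "(\<Sum>i<4. \<bar>v i \<bullet> (mat 1 *v y)\<bar>) = (\<Sum>i<4. \<bar>u i \<bullet> y\<bar>)" for y
    by (rule sum_abs_inner_transformed[OF \<sigma>, where s = s])
       (use s in \<open>auto simp: v_def orthogonal_matrix_id\<close>)
  hence E: "energy 4 v = energy 4 u" by (simp add: energy_def)
  show "sqrt 5 \<le> energy 4 u"
    using four_vectors_energy_bound(1)[OF v x(1,2)] x(3) by (simp add: E flip: v_def)
  assume "energy 4 u \<le> sqrt 5"
  hence pyr: "pyramid v"
    using four_vectors_energy_bound(2)[OF v x(1,2)] x(3) by (simp add: E flip: v_def)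
  obtain f :: "real ^ 3 \<Rightarrow> real ^ 3" where f: "orthogonal_transformation f" "f (v 0) = axis 3 1"
    using orthogonal_transformation_exists_1[of "v 0" "axis 3 1 :: real ^ 3"] norm_v by (auto simp: norm_axis_1)
  define Q where "Q = matrix f"
  have Qf: "Q *v y = f y" for y
    using matrix_vector_mul(2)[OF orthogonal_transformation_linear[OF f(1)]] unfolding Q_def by (rule fun_cong)
  have Q: "orthogonal_matrix Q" using f by (simp add: Q_def orthogonal_transformation_matrix)
  have inner: "f a \<bullet> f b = a \<bullet> b" for a b using f by (simp add: orthogonal_transformation_def)
  have equ: "f (v i) \<in> equator" if "i < 4" "v 0 \<bullet> v i = 0" for i
  proof -
    have "f (v i) $ 3 = axis 3 1 \<bullet> f (v i)" by (simp add: inner_axis inner_commute)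
    also have "\<dots> = 0" using that(2) inner[of "v 0" "v i"] by (simp add: f(2))
    finally show ?thesis
      using norm_v[OF that(1)] f(1) by (simp add: equator_def orthogonal_transformation_norm)
  qed
  have sum0: "v 1 + v 2 + v 3 = 0" using pyr by (simp add: pyramid_def)
  have diag: "v i \<bullet> v i = 1" if "i < 4" for i using norm_v[OF that] by (simp add: dot_square_norm)
  have "v i \<bullet> (v 1 + v 2 + v 3) = 0" for i by (simp only: sum0 inner_zero_right)
  from this[of 1] this[of 2] this[of 3]
  have G: "v 1 \<bullet> v 2 = - 1 / 2" "v 2 \<bullet> v 3 = - 1 / 2" "v 3 \<bullet> v 1 = - 1 / 2"
    by (simp_all add: inner_add_right diag inner_commute)
  have "dist (f a) (f b) = sqrt (a \<bullet> a + b \<bullet> b - 2 * (a \<bullet> b))" for a b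
  proof -
    have "dist (f a) (f b) = dist a b"
      using f by (simp add: orthogonal_transformation_isometry)
    thus ?thesis
      by (simp add: dist_norm norm_eq_sqrt_inner inner_diff_left inner_diff_right inner_commute)
  qed
  hence d: "dist (f (v 1)) (f (v 2)) = sqrt 3" "dist (f (v 2)) (f (v 3)) = sqrt 3"
    "dist (f (v 3)) (f (v 1)) = sqrt 3" by (simp_all add: diag G del: One_nat_def)
  hence "f (v 1) \<noteq> f (v 2)" by auto
  with d have "equilateral_triangle (f (v 1)) (f (v 2)) (f (v 3))"
    by (simp add: equilateral_triangle_def)
  moreover have "f (v 1) \<in> equator" "f (v 2) \<in> equator" "f (v 3) \<in> equator"
    using pyr by (auto simp: pyramid_def intro: equ)
  moreover have "\<forall>i<4. f (v i) = Q *v (s i *\<^sub>R u (\<sigma> i))" by (simp add: Qf v_def)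
  moreover have "\<forall>i<4. s i \<in> {1, - 1}" using s by blast
  moreover have "f (v 0) \<in> {axis 3 1, - axis 3 1}" using f(2) by simp
  ultimately show "triangular_pyramid_type u"
    unfolding triangular_pyramid_type_def using \<sigma> Q
    by (intro exI[of _ \<sigma>] exI[of _ s] exI[of _ Q] exI[of _ "\<lambda>i. f (v i)"] conjI)
qed

lemma triangular_pyramid_config_exists:
  "\<exists>u\<in>configs 4. triangular_pyramid_type u"
proof
  define u :: "nat \<Rightarrow> real ^ 3" where
    "u i = (if i = 0 then axis 3 1 else if i = 1 then vector [1, 0, 0]
       else if i = 2 then vector [- 1 / 2, sqrt 3 / 2, 0] else vector [- 1 / 2, - sqrt 3 / 2, 0])" for i
  have ip: "x \<bullet> y = x $ 1 * y $ 1 + x $ 2 * y $ 2 + x $ 3 * y $ 3" for x y :: "real ^ 3"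
    by (simp add: inner_vec_def sum_3)
  have norm: "norm (u i) = 1" for i
    by (simp add: u_def axis_def norm_eq_sqrt_inner ip)
  thus "u \<in> configs 4" by (simp add: configs_def)
  have "equilateral_triangle (u 1) (u 2) (u 3)"
    by (simp add: equilateral_triangle_def u_def dist_norm norm_eq_sqrt_inner ip vec_eq_iff forall_3)
  moreover have "u 1 \<in> equator" "u 2 \<in> equator" "u 3 \<in> equator"
    using norm by (simp_all add: equator_def) (simp_all add: u_def)
  moreover have "u 0 = axis 3 1" by (simp add: u_def)
  ultimately show "triangular_pyramid_type u"
    unfolding triangular_pyramid_type_def
    by (intro exI[of _ id] exI[of _ "\<lambda>_. 1"] exI[of _ "mat 1"] exI[of _ u])
       (auto simp: permutes_id orthogonal_matrix_id)
qed

section \<open>The minimal energies and their designs\<close>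

theorem theorem2p7:
  fixes n :: nat
  assumes "n \<ge> 1"
  shows "(CARD('p::finite) \<ge> n \<longrightarrow>
            min_energy TYPE('p) n = sqrt (real n) \<and>
            (\<forall>u\<in>(configs n :: (nat \<Rightarrow> real ^ 'p) set).
               minimax_design n u \<longleftrightarrow> pairwise (\<lambda>i j. orthogonal (u i) (u j)) {..<n})) \<and>
         (min_energy TYPE(2) n = 1 / sin (pi / (2 * real n)) \<and>
            (\<forall>u\<in>(configs n :: (nat \<Rightarrow> real ^ 2) set).
               minimax_design n u \<longleftrightarrow>
                 (\<exists>A. rotation_matrix A \<and>
                    (\<Union>i<n. {u i, - u i}) =
                    (\<lambda>z. A *v complex_to_vec z) `
                      {exp (of_nat k * of_real pi * \<i> / of_nat n) |k. k \<in> {0..2 * n - 1}}))) \<and>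
         (min_energy TYPE(3) 4 = sqrt 5 \<and>
            (\<forall>u\<in>(configs 4 :: (nat \<Rightarrow> real ^ 3) set).
               minimax_design 4 u \<longleftrightarrow> triangular_pyramid_type u))"
proof -
  have orthonormal: "min_energy TYPE('p) n = sqrt (real n) \<and>
      (\<forall>u\<in>(configs n :: (nat \<Rightarrow> real ^ 'p) set).
         minimax_design n u \<longleftrightarrow> pairwise (\<lambda>i j. orthogonal (u i) (u j)) {..<n})"
    if card: "CARD('p) \<ge> n"
  proof -
    obtain u0 :: "nat \<Rightarrow> real ^ 'p" where u0: "u0 \<in> configs n"
      "pairwise (\<lambda>i j. orthogonal (u0 i) (u0 j)) {..<n}"
      using orthonormal_config_exists[OF card] by blast
    show ?thesis
      by (rule minimax_design_iff[where n = n and c = "sqrt (real n)"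
            and P = "\<lambda>u :: nat \<Rightarrow> real ^ 'p. pairwise (\<lambda>i j. orthogonal (u i) (u j)) {..<n}",
            OF sqrt_le_energy orthogonal_if_energy_le_sqrt energy_le_sqrt_if_orthogonal u0])
  qed
  obtain u2 where u2: "u2 \<in> configs n" "evenly_spaced n u2"
    using evenly_spaced_config_exists[OF assms] by blast
  have planar: "min_energy TYPE(2) n = 1 / sin (pi / (2 * real n)) \<and>
      (\<forall>u\<in>configs n. minimax_design n u \<longleftrightarrow> evenly_spaced n u)"
    by (rule minimax_design_iff[where P = "evenly_spaced n",
          OF planar_energy_lower_bound[OF assms] energy_le_if_evenly_spaced[OF assms] u2])
  obtain u3 where u3: "u3 \<in> configs 4" "triangular_pyramid_type u3"
    using triangular_pyramid_config_exists by blast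
  have spatial: "min_energy TYPE(3) 4 = sqrt 5 \<and>
      (\<forall>u\<in>configs 4. minimax_design 4 u \<longleftrightarrow> triangular_pyramid_type u)"
    by (rule minimax_design_iff[where P = triangular_pyramid_type,
          OF spatial_energy_lower_bound energy_le_if_triangular_pyramid_type u3])
  show ?thesis
    by (rule conjI[OF _ conjI[OF planar[unfolded
            evenly_spaced_iff_rotated_roots_of_unity[OF assms]] spatial]], rule impI, rule orthonormal)
qed

end
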